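(* Let $\Psi:\mathbb{R}_+\to\mathbb{R}_+$ be an approximation function, fix an integer $d\ge 2$ and integers $Q_2>Q_1\ge 1$. Then there exist constants $H(d),H'(d),C(d),C'(d)>0$ and, for each choice $\mathbb{X}_d\in\{\mathbb{A}_d,\mathbb{A}'_d\}$, constants $C_1(\mathbb{X}_d),C_2(\mathbb{X}_d)>0$ such that, defining $$E_{\mathbb{X}_d}(H)=\begin{cases} C(d)\sqrt{(\log H)^{l(d)}/H} & \text{if } \mathbb{X}_d=\mathbb{A}_d \text{ and } H\ge H(d),\\ C'(d)(\log H)^{l(d)}/H & \text{if } \mathbb{X}_d=\mathbb{A}'_d \text{ and } H\ge H'(d),\end{cases}$$ the following hold for every integer $H$ for which $E_{\mathbb{X}_d}(H)$ is defined (i.e. $H\ge H(d)$, resp. $H\ge H'(d)$): \begin{itemize} \item (Upper bound.) Let $\Theta_\Psi(Q_1,Q_2)=\min_{Q_1\le q<Q_2} 2\Psi(q)/q$. For every $\delta\in(0,1)$ with $\Theta_\Psi(Q_1,Q_2)<C_1(\mathbb{X}_d)\,\delta$, $$\frac{\#(J_\Psi(Q_1,Q_2)\cap\mathbb{X}_d(H))}{\#\mathbb{X}_d(H)}\le C_2(\mathbb{X}_d)\,|J_\Psi(Q_1,Q_2)|\,(1+\Theta_\Psi(Q_1,Q_2))\left(\frac{1}{1-\delta}+\frac{E_{\mathbb{X}_d}(H)}{\Theta_\Psi(Q_1,Q_2)}\right).$$ \item (Lower bound.) Let $\widetilde J_\Psi(Q_1,Q_2)$ be the closure of $[0,1]\setminus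 J_\Psi(Q_1,Q_2)$ and $\ell=len^*(\widetilde J_\Psi(Q_1,Q_2))$. If $\ell=0$, then $J_\Psi(Q_1,Q_2)=[0,1]$ and $\#(J_\Psi(Q_1,Q_2)\cap\mathbb{X}_d(H))/\#\mathbb{X}_d(H)=1$. If $\ell>0$, then for every $\delta\in(0,1)$ with $\ell<C_1(\mathbb{X}_d)\,\delta$, $$1-\frac{\#(J_\Psi(Q_1,Q_2)\cap\mathbb{X}_d(H))}{\#\mathbb{X}_d(H)}\le C_2(\mathbb{X}_d)\,|\widetilde J_\Psi(Q_1,Q_2)|\,(1+\ell)\left(\frac{1}{1-\delta}+\frac{E_{\mathbb{X}_d}(H)}{\ell}\right).$$ \end{itemize}
   Context: An approximation function is a nonincreasing function $\Psi:\mathbb{R}_+\to\mathbb{R}_+$ tending to $0$ at infinity. For $x\in\mathbb{R}$, $r>0$, $B^*(x,r)=[x-r,x+r]\cap[0,1]$, and $J_\Psi(Q_1,Q_2)=\bigcup_{Q_1\le q<Q_2}\bigcup_{0\le p\le q}B^*(p/q,\Psi(q)/q)$. $|E|$ denotes Lebesgue measure. For integers $d\ge 1$, $H\ge1$, $\mathbb{A}_d(H)$ is the set of real algebraic numbers of degree exactly $d$ whose naive height (maximum absolute value of the coefficients of the primitive minimal polynomial in $\mathbb{Z}[X]$) is at most $H$, and $\mathbb{A}'_d(H)=\mathbb{A}_d(H)\cap[0,1]$. $\mathbb{X}_d(H)$ denotes either $\mathbb{A}_d(H)$ or $\mathbb{A}'_d(H)$, and $\#(J\cap\mathbb{X}_d(H))$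 denotes the number of $\alpha\in\mathbb{X}_d(H)$ whose reduction modulo one $\alpha-\lfloor\alpha\rfloor$ lies in $J$. $l(d)=1$ if $d=2$ and $l(d)=0$ otherwise. For a finite union of closed intervals $\Omega\subset[0,1]$, $len^*(\Omega)$ is the minimal length of its connected components (taken to be $0$ if $\Omega$ is empty). *)

theory Defs
  imports
    "HOL-Analysis.Analysis"
    "HOL-Computational_Algebra.Computational_Algebra"
begin

section \<open>Approximation functions and the sets they define\<close>

(* Only values at positive arguments are constrained, so that functions such as 1/x, undefined
   at 0 on paper, are included; a function on the closed half-line restricts to this setting.
   The value 0 is allowed. *)
definition approximation_function :: "(real \<Rightarrow> real) \<Rightarrow> bool" where
  "approximation_function \<Psi> \<longleftrightarrow>
     (\<forall>x>0. 0 \<le> \<Psi> x) \<and> antimono_on {0<..} \<Psi> \<and> (\<Psi> \<longlongrightarrow> 0) at_top"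

definition Bstar :: "real \<Rightarrow> real \<Rightarrow> real set" where
  "Bstar x r = {x - r..x + r} \<inter> {0..1}"

definition J_set :: "(real \<Rightarrow> real) \<Rightarrow> nat \<Rightarrow> nat \<Rightarrow> real set" where
  "J_set \<Psi> Q1 Q2 =
     (\<Union>q\<in>{Q1..<Q2}. \<Union>p\<in>{0..q}. Bstar (real p / real q) (\<Psi> (real q) / real q))"

definition J_tilde :: "(real \<Rightarrow> real) \<Rightarrow> nat \<Rightarrow> nat \<Rightarrow> real set" where
  "J_tilde \<Psi> Q1 Q2 = closure ({0..1} - J_set \<Psi> Q1 Q2)"

definition Theta_min :: "(real \<Rightarrow> real) \<Rightarrow> nat \<Rightarrow> nat \<Rightarrow> real" where
  "Theta_min \<Psi> Q1 Q2 = Min ((\<lambda>q. 2 * \<Psi> (real q) / real q) ` {Q1..<Q2})"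

(* Meant for finite unions of closed intervals, which have finitely many components. *)
definition min_component_length :: "real set \<Rightarrow> real" where
  "min_component_length \<Omega> =
     (if \<Omega> = {} then 0 else Min (measure lebesgue ` components \<Omega>))"

section \<open>Real algebraic numbers of given degree and bounded height\<close>

(* Determined by \<alpha> up to sign, which affects neither the degree nor the naive height. *)
definition primitive_min_poly :: "int poly \<Rightarrow> real \<Rightarrow> bool" where
  "primitive_min_poly p \<alpha> \<longleftrightarrow>
     p \<noteq> 0 \<and> content p = 1 \<and> poly (map_poly real_of_int p) \<alpha> = 0 \<and>
     (\<forall>q::int poly. q \<noteq> 0 \<and> poly (map_poly real_of_int q) \<alpha> = 0 \<longrightarrow> degree p \<le> degree q)"

definition naive_height :: "int poly \<Rightarrow> int" where
  "naive_height p = Max ((\<lambda>i. \<bar>coeff p i\<bar>) ` {..degree p})"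

definition alg_numbers :: "nat \<Rightarrow> nat \<Rightarrow> real set" where
  "alg_numbers d H =
     {\<alpha>. \<exists>p. primitive_min_poly p \<alpha> \<and> degree p = d \<and> naive_height p \<le> int H}"

definition alg_numbers_unit :: "nat \<Rightarrow> nat \<Rightarrow> real set" where
  "alg_numbers_unit d H = alg_numbers d H \<inter> {0..1}"

datatype alg_family = Whole_Line | Unit_Interval

fun family_set :: "alg_family \<Rightarrow> nat \<Rightarrow> nat \<Rightarrow> real set" where
  "family_set Whole_Line d H = alg_numbers d H"
| "family_set Unit_Interval d H = alg_numbers_unit d H"

(* Membership in J is tested modulo one, but the numbers themselves are counted: distinct
   elements of the family with the same fractional part count separately. *)
definition proportion_in :: "real set \<Rightarrow> alg_family \<Rightarrow> nat \<Rightarrow> nat \<Rightarrow> real" where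
  "proportion_in J X d H =
     real (card {\<alpha> \<in> family_set X d H. frac \<alpha> \<in> J}) / real (card (family_set X d H))"

section \<open>The error term\<close>

definition log_exponent :: "nat \<Rightarrow> nat" where
  "log_exponent d = (if d = 2 then 1 else 0)"

(* The constants for the two families are passed together; each family uses its own one. *)
fun height_threshold :: "real \<Rightarrow> real \<Rightarrow> alg_family \<Rightarrow> real" where
  "height_threshold H0 H0' Whole_Line = H0"
| "height_threshold H0 H0' Unit_Interval = H0'"

fun error_term :: "real \<Rightarrow> real \<Rightarrow> alg_family \<Rightarrow> nat \<Rightarrow> nat \<Rightarrow> real" where
  "error_term C C' Whole_Line d H = C * sqrt (ln (real H) ^ log_exponent d / real H)"
| "error_term C C' Unit_Interval d H = C' * ln (real H) ^ log_exponent d / real H"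

end

theory Submission
  imports Defs
begin

text \<open>Both bounds reduce to an estimate for one interval \<open>c\<close> of length \<open>l\<close>: the proportion of the
  family with fractional part in \<open>c\<close> is at most a constant times \<open>l + e\<close>, where \<open>e\<close> is \<open>1 / H\<close> for
  algebraic numbers in the unit interval and \<open>1 / sqrt H\<close> for all of them. Summing over the
  components of the set, each of length at least \<open>m\<close>, replaces \<open>l + e\<close> by \<open>\<bar>S\<bar> (1 + e / m)\<close>.

  The interval estimate needs no asymptotic formula. An integer polynomial of height at most \<open>H\<close>
  with a root near \<open>x\<close> takes a value of size \<open>O(l H)\<close> at \<open>x\<close>, so its constant coefficient has only
  \<open>O(l H + 1)\<close> choices once the others are fixed; this gives \<open>O(l H ^ (d + 1) + H ^ d)\<close> roots.
  Numbers outside the unit interval are brought into it by inversion. The family itself has at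
  least a constant times \<open>H ^ (d + 1)\<close> elements, since this many primitive polynomials are
  Eisenstein at 2 and change sign on the unit interval.\<close>

section \<open>Counting roots of polynomials of bounded height\<close>

abbreviation ipoly :: "int poly \<Rightarrow> real \<Rightarrow> real" where
  "ipoly p x \<equiv> poly (map_poly real_of_int p) x"

lemma ipoly_pCons: "ipoly (pCons a p) x = of_int a + x * ipoly p x"
  by (simp add: map_poly_pCons)

lemma ipoly_smult: "ipoly (smult a p) x = of_int a * ipoly p x"
  by (simp add: map_poly_smult)

lemma ipoly_add: "ipoly (p + q) x = ipoly p x + ipoly q x"
proof -
  have "map_poly real_of_int (p + q) = map_poly real_of_int p + map_poly real_of_int q"
    by (rule poly_eqI) (simp add: coeff_map_poly)
  then show ?thesis by simp
qed

lemma ipoly_diff: "ipoly (p - q) x = ipoly p x - ipoly q x"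
  using ipoly_add[of "p - q" q x] by simp

lemma ipoly_mult: "ipoly (p * q) x = ipoly p x * ipoly q x"
  by (induction p) (simp_all add: ipoly_pCons ipoly_add ipoly_smult algebra_simps)

lemma ipoly_monom: "ipoly (monom a n) x = of_int a * x ^ n"
  by (simp add: map_poly_monom poly_monom)

lemma ipoly_altdef:
  assumes "\<forall>i\<ge>n. coeff p i = 0"
  shows "ipoly p x = (\<Sum>i<n. of_int (coeff p i) * x ^ i)"
proof (cases "p = 0")
  case False
  have "degree p < n"
    by (metis False assms leading_coeff_0_iff not_le)
  have "ipoly p x = (\<Sum>i\<le>degree p. of_int (coeff p i) * x ^ i)"
    by (simp add: poly_altdef coeff_map_poly degree_map_poly)
  also have "\<dots> = (\<Sum>i<n. of_int (coeff p i) * x ^ i)"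
    using \<open>degree p < n\<close> by (intro sum.mono_neutral_left) (auto simp: coeff_eq_0 not_le)
  finally show ?thesis .
qed simp

lemma map_poly_of_int_eq_0_iff: "map_poly real_of_int p = 0 \<longleftrightarrow> p = 0"
  by (rule map_poly_eq_0_iff) auto

lemma finite_ipoly_roots: "p \<noteq> 0 \<Longrightarrow> finite {x. ipoly p x = 0}"
  by (rule poly_roots_finite) (simp add: map_poly_of_int_eq_0_iff)

lemma card_ipoly_roots:
  assumes "p \<noteq> 0"
  shows "card {x. ipoly p x = 0} \<le> degree p"
proof -
  have "card {x. ipoly p x = 0} \<le> degree (map_poly real_of_int p)"
    using assms by (intro card_poly_roots_bound) (simp add: map_poly_of_int_eq_0_iff)
  also have "\<dots> = degree p"
    by (rule degree_map_poly) auto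
  finally show ?thesis .
qed

text \<open>The parameter \<open>n\<close> counts coefficients, so degrees stay below
  \<open>n\<close>. No degree is fixed, which makes the box a product over coefficient positions and
  lets \<open>pCons\<close> split off the constant one.\<close>

definition poly_box :: "'a::zero set \<Rightarrow> nat \<Rightarrow> 'a poly set" where
  "poly_box A n = {p. (\<forall>i<n. coeff p i \<in> A) \<and> (\<forall>i\<ge>n. coeff p i = 0)}"

lemma poly_box_0: "poly_box A 0 = {0}"
  by (auto simp: poly_box_def intro: poly_eqI)

lemma pCons_in_poly_box_iff:
  "pCons a p \<in> poly_box A (Suc n) \<longleftrightarrow> a \<in> A \<and> p \<in> poly_box A n"
  unfolding poly_box_def
  by (auto simp: coeff_pCons split: nat.splits)

lemma poly_box_Suc: "poly_box A (Suc n) = (\<lambda>(a, p). pCons a p) ` (A \<times> poly_box A n)"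
proof -
  have "p \<in> (\<lambda>(a, p). pCons a p) ` (A \<times> poly_box A n)" if "p \<in> poly_box A (Suc n)" for p
    using that by (cases p) (auto simp: pCons_in_poly_box_iff)
  then show ?thesis
    by (auto simp: pCons_in_poly_box_iff)
qed

lemma finite_poly_box: "finite A \<Longrightarrow> finite (poly_box A n)"
  by (induction n) (simp_all add: poly_box_0 poly_box_Suc)

lemma card_poly_box: "card (poly_box A n) = card A ^ n"
proof (induction n)
  case (Suc n)
  have "inj_on (\<lambda>(a, p). pCons a p) (A \<times> poly_box A n)"
    by (auto simp: inj_on_def)
  then show ?case
    by (simp add: poly_box_Suc card_image card_cartesian_product Suc)
qed (simp add: poly_box_0)

text \<open>Neither minimality nor exact degree is asked of \<open>p\<close>: the upper bounds only
  need a superset of the algebraic numbers that behaves well under unions and inversion.\<close>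

definition bounded_height_roots :: "nat \<Rightarrow> nat \<Rightarrow> real set \<Rightarrow> real set" where
  "bounded_height_roots d H I =
     {\<alpha> \<in> I. \<exists>p \<in> poly_box {- int H..int H} (Suc d). p \<noteq> 0 \<and> ipoly p \<alpha> = 0}"

lemma bounded_height_roots_mono: "I \<subseteq> I' \<Longrightarrow> bounded_height_roots d H I \<subseteq> bounded_height_roots d H I'"
  by (auto simp: bounded_height_roots_def)

lemma bounded_height_roots_UNION:
  "bounded_height_roots d H (\<Union>i\<in>K. f i) = (\<Union>i\<in>K. bounded_height_roots d H (f i))"
  by (auto simp: bounded_height_roots_def)

lemma bounded_height_roots_Un:
  "bounded_height_roots d H (I \<union> I') = bounded_height_roots d H I \<union> bounded_height_roots d H I'"
  by (auto simp: bounded_height_roots_def)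

lemma degree_poly_box: "p \<in> poly_box A (Suc d) \<Longrightarrow> degree p \<le> d"
  by (auto simp: poly_box_def intro!: degree_le)

lemma finite_bounded_height_roots: "finite (bounded_height_roots d H I)"
proof (rule finite_subset)
  show "bounded_height_roots d H I
      \<subseteq> (\<Union>p\<in>poly_box {- int H..int H} (Suc d) - {0}. {x. ipoly p x = 0})"
    by (auto simp: bounded_height_roots_def)
qed (auto intro!: finite_poly_box finite_ipoly_roots)

lemma card_int_interval_le:
  fixes c B :: real
  assumes "0 \<le> B"
  shows "finite {a :: int. \<bar>of_int a + c\<bar> \<le> B}" "card {a :: int. \<bar>of_int a + c\<bar> \<le> B} \<le> 2 * B + 1"
proof -
  have eq: "{a :: int. \<bar>of_int a + c\<bar> \<le> B} = {\<lceil>- B - c\<rceil>..\<lfloor>B - c\<rfloor>}"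
    by (auto simp: abs_le_iff ceiling_le_iff le_floor_iff)
  show "finite {a :: int. \<bar>of_int a + c\<bar> \<le> B}" by (simp add: eq)
  show "card {a :: int. \<bar>of_int a + c\<bar> \<le> B} \<le> 2 * B + 1"
    unfolding eq card_atLeastAtMost_int using assms by linarith
qed

text \<open>The value at \<open>x\<close> is \<open>a + x * ipoly q x\<close> with \<open>a\<close>
  the constant coefficient. Each of the \<open>(2 * H + 1) ^ d\<close> choices of \<open>q\<close>
  confines the integer \<open>a\<close> to an interval of length \<open>2 * B\<close>.\<close>

lemma card_poly_box_small_value:
  assumes "0 \<le> B"
  shows "card {p \<in> poly_box {- int H..int H} (Suc d). \<bar>ipoly p x\<bar> \<le> B}
    \<le> (2 * B + 1) * (2 * real H + 1) ^ d" (is "real (card ?P) \<le> _")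
proof -
  let ?Q = "poly_box {- int H..int H} d"
  let ?A = "\<lambda>q. {a :: int. \<bar>of_int a + x * ipoly q x\<bar> \<le> B}"
  have fin: "finite (SIGMA q:?Q. ?A q)"
    using card_int_interval_le(1)[OF assms] by (auto intro: finite_poly_box)
  have "?P \<subseteq> (\<lambda>(q, a). pCons a q) ` (SIGMA q:?Q. ?A q)"
    by (auto simp: poly_box_Suc ipoly_pCons)
  then have "card ?P \<le> card (SIGMA q:?Q. ?A q)"
    using fin by (rule surj_card_le[rotated])
  also have "\<dots> = (\<Sum>q\<in>?Q. card (?A q))"
    using card_int_interval_le(1)[OF assms] by (intro card_SigmaI finite_poly_box) auto
  finally have "real (card ?P) \<le> real (\<Sum>q\<in>?Q. card (?A q))"
    by (simp only: of_nat_le_iff)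
  also have "\<dots> = (\<Sum>q\<in>?Q. real (card (?A q)))"
    by simp
  also have "\<dots> \<le> (\<Sum>q\<in>?Q. 2 * B + 1)"
    by (intro sum_mono card_int_interval_le(2) assms)
  also have "\<dots> = (2 * B + 1) * real (card ?Q)"
    by simp
  also have "real (card ?Q) = (2 * real H + 1) ^ d"
    by (simp add: card_poly_box nat_add_distrib nat_mult_distrib algebra_simps)
  finally show ?thesis .
qed

lemma abs_ipoly_diff_le:
  assumes p: "p \<in> poly_box {- int H..int H} (Suc d)" and "\<bar>x\<bar> \<le> 1" "\<bar>y\<bar> \<le> 1"
  shows "\<bar>ipoly p x - ipoly p y\<bar> \<le> (real d + 1)\<^sup>2 * real H * \<bar>x - y\<bar>"
proof -
  have "ipoly p x - ipoly p y = (\<Sum>i<Suc d. of_int (coeff p i) * (x ^ i - y ^ i))"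
    using p by (subst (1 2) ipoly_altdef[of "Suc d"])
      (auto simp: poly_box_def sum_subtractf algebra_simps simp del: sum.lessThan_Suc)
  also have "\<bar>\<dots>\<bar> \<le> (\<Sum>i<Suc d. \<bar>of_int (coeff p i) * (x ^ i - y ^ i)\<bar>)"
    by (rule sum_abs)
  also have "\<dots> \<le> (\<Sum>i<Suc d. real H * ((real d + 1) * \<bar>x - y\<bar>))"
  proof (rule sum_mono)
    fix i assume i: "i \<in> {..<Suc d}"
    have "\<bar>coeff p i\<bar> \<le> int H"
      using p i by (force simp: poly_box_def)
    then have "\<bar>real_of_int (coeff p i)\<bar> \<le> real H"
      by linarith
    moreover have "\<bar>x ^ i - y ^ i\<bar> \<le> (real d + 1) * \<bar>x - y\<bar>"
    proof -
      have "\<bar>x ^ i - y ^ i\<bar> \<le> real i * \<bar>x - y\<bar>"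
        using norm_power_diff[of x y i] assms by simp
      also have "\<dots> \<le> (real d + 1) * \<bar>x - y\<bar>"
        using i by (intro mult_right_mono) auto
      finally show ?thesis .
    qed
    ultimately show "\<bar>of_int (coeff p i) * (x ^ i - y ^ i)\<bar> \<le> real H * ((real d + 1) * \<bar>x - y\<bar>)"
      unfolding abs_mult by (intro mult_mono) auto
  qed
  also have "\<dots> = (real d + 1)\<^sup>2 * real H * \<bar>x - y\<bar>"
    by (simp add: power2_eq_square algebra_simps)
  finally show ?thesis .
qed

text \<open>The factors come from the roots per polynomial (\<open>d\<close>, rounded up), from
  \<open>2 * H + 1 \<le> 3 * H\<close> for \<open>d\<close> coefficients, and from the choices of
  the constant coefficient.\<close>

definition root_const :: "nat \<Rightarrow> real" where
  "root_const d = (real d + 1) * 3 ^ d * (2 * (real d + 1)\<^sup>2 + 1)"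

lemma root_const_pos: "0 < root_const d"
  by (auto simp: root_const_def intro!: mult_pos_pos add_nonneg_pos)

text \<open>Fix a point \<open>x\<close> of the short set \<open>I\<close>: a polynomial with a root in \<open>I\<close> is small at \<open>x\<close>, so
  its nonconstant coefficients leave few choices for the constant one.\<close>

lemma card_bounded_height_roots_le:
  assumes H: "1 \<le> H" and I: "I \<subseteq> {-1..1}" and \<open>0 \<le> l\<close>
    and diam: "\<And>x y. x \<in> I \<Longrightarrow> y \<in> I \<Longrightarrow> \<bar>x - y\<bar> \<le> l"
  shows "card (bounded_height_roots d H I) \<le> root_const d * (l * real H ^ Suc d + real H ^ d)"
proof (cases "I = {}")
  case True
  then show ?thesis
    using root_const_pos[of d] \<open>0 \<le> l\<close> by (simp add: bounded_height_roots_def)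
next
  case False
  then obtain x where x: "x \<in> I" by auto
  define B where "B = (real d + 1)\<^sup>2 * real H * l"
  have B: "0 \<le> B" using \<open>0 \<le> l\<close> by (simp add: B_def)
  define P where "P = {p \<in> poly_box {- int H..int H} (Suc d). \<bar>ipoly p x\<bar> \<le> B}"
  have finP: "finite P" by (simp add: P_def finite_poly_box)
  have "bounded_height_roots d H I \<subseteq> (\<Union>p\<in>P - {0}. {\<alpha>. ipoly p \<alpha> = 0})"
  proof
    fix \<alpha> assume "\<alpha> \<in> bounded_height_roots d H I"
    then obtain p where p: "\<alpha> \<in> I" "p \<in> poly_box {- int H..int H} (Suc d)" "p \<noteq> 0" "ipoly p \<alpha> = 0"
      by (auto simp: bounded_height_roots_def)
    have "\<bar>ipoly p x - ipoly p \<alpha>\<bar> \<le> (real d + 1)\<^sup>2 * real H * \<bar>x - \<alpha>\<bar>"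
      using I x p by (intro abs_ipoly_diff_le) (auto simp: abs_le_iff)
    also have "\<dots> \<le> B"
      unfolding B_def using diam[OF x p(1)] by (intro mult_left_mono) auto
    finally show "\<alpha> \<in> (\<Union>p\<in>P - {0}. {\<alpha>. ipoly p \<alpha> = 0})"
      using p by (auto simp: P_def)
  qed
  then have "card (bounded_height_roots d H I) \<le> card (\<Union>p\<in>P - {0}. {\<alpha>. ipoly p \<alpha> = 0})"
    using finP by (intro card_mono) (auto intro: finite_ipoly_roots)
  also have "\<dots> \<le> (\<Sum>p\<in>P - {0}. card {\<alpha>. ipoly p \<alpha> = 0})"
    using finP by (intro card_UN_le) auto
  also have "\<dots> \<le> (\<Sum>p\<in>P - {0}. d)"
  proof (rule sum_mono)
    fix p assume "p \<in> P - {0}"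
    then show "card {\<alpha>. ipoly p \<alpha> = 0} \<le> d"
      using card_ipoly_roots[of p] degree_poly_box[of p _ d] by (force simp: P_def)
  qed
  also have "\<dots> = card (P - {0}) * d"
    by simp
  also have "\<dots> \<le> card P * (d + 1)"
    using finP by (intro mult_mono card_mono) auto
  finally have "real (card (bounded_height_roots d H I)) \<le> (real d + 1) * card P"
    by (metis (no_types) Suc_eq_plus1 add.commute mult.commute of_nat_Suc of_nat_le_iff of_nat_mult)
  also have "real (card P) \<le> (2 * B + 1) * (2 * real H + 1) ^ d"
    unfolding P_def by (rule card_poly_box_small_value[OF B])
  also have "(2 * real H + 1) ^ d \<le> (3 * real H) ^ d"
    using H by (intro power_mono) auto
  also have "(2 * B + 1) \<le> (2 * (real d + 1)\<^sup>2 + 1) * (l * real H + 1)"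
  proof -
    have "(2 * (real d + 1)\<^sup>2 + 1) * (l * real H + 1)
        = 2 * B + 1 + l * real H + 2 * (real d + 1)\<^sup>2"
      by (simp add: B_def algebra_simps)
    moreover have "0 \<le> l * real H" using \<open>0 \<le> l\<close> by simp
    ultimately show ?thesis by simp
  qed
  finally have "real (card (bounded_height_roots d H I))
      \<le> (real d + 1) * ((2 * (real d + 1)\<^sup>2 + 1) * (l * real H + 1) * (3 * real H) ^ d)"
    using B by (simp add: mult_left_mono mult_right_mono)
  also have "\<dots> = root_const d * (l * real H ^ Suc d + real H ^ d)"
    by (simp add: root_const_def power_mult_distrib algebra_simps)
  finally show ?thesis .
qed

section \<open>Inversion and roots outside [-1, 1]\<close>

lemma ipoly_reflect_poly: "x \<noteq> 0 \<Longrightarrow> ipoly (reflect_poly p) x = x ^ degree p * ipoly p (inverse x)"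
proof -
  assume x: "x \<noteq> 0"
  have "map_poly real_of_int (reflect_poly p) = reflect_poly (map_poly real_of_int p)"
    by (rule poly_eqI) (simp add: coeff_map_poly coeff_reflect_poly degree_map_poly)
  then show ?thesis
    using x by (simp add: poly_reflect_poly_nz degree_map_poly)
qed

text \<open>Reversing the coefficients of \<open>p\<close> keeps the height bound, does not raise
  the degree, and turns a nonzero root into its inverse.\<close>

lemma inverse_bounded_height_roots:
  assumes "0 \<notin> I"
  shows "inverse ` bounded_height_roots d H I \<subseteq> bounded_height_roots d H (inverse ` I)"
proof
  fix \<beta> assume "\<beta> \<in> inverse ` bounded_height_roots d H I"
  then obtain \<alpha> p where \<alpha>: "\<beta> = inverse \<alpha>" "\<alpha> \<in> I"
    and p: "p \<in> poly_box {- int H..int H} (Suc d)" "p \<noteq> 0" "ipoly p \<alpha> = 0"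
    by (auto simp: bounded_height_roots_def)
  have "reflect_poly p \<in> poly_box {- int H..int H} (Suc d)"
    using p degree_poly_box[OF p(1)] by (auto simp: poly_box_def coeff_reflect_poly)
  moreover have "\<alpha> \<noteq> 0" using assms \<alpha> by auto
  ultimately show "\<beta> \<in> bounded_height_roots d H (inverse ` I)"
    using \<alpha> p ipoly_reflect_poly[of \<beta> p]
    by (auto simp: bounded_height_roots_def intro!: bexI[of _ "reflect_poly p"])
qed

lemma card_bounded_height_roots_far:
  assumes H: "1 \<le> H" and k: "1 \<le> k" and I: "\<And>x. x \<in> I \<Longrightarrow> k \<le> \<bar>x\<bar>" and "0 \<le> l"
    and diam: "\<And>x y. x \<in> I \<Longrightarrow> y \<in> I \<Longrightarrow> \<bar>inverse x - inverse y\<bar> \<le> l"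
  shows "card (bounded_height_roots d H I) \<le> root_const d * (l * real H ^ Suc d + real H ^ d)"
proof -
  have nz: "0 \<notin> I" using k I by force
  have "card (bounded_height_roots d H I) = card (inverse ` bounded_height_roots d H I)"
    by (intro card_image[symmetric]) (simp add: inj_on_def)
  also have "\<dots> \<le> card (bounded_height_roots d H (inverse ` I))"
    by (intro card_mono finite_bounded_height_roots inverse_bounded_height_roots nz)
  also have "real \<dots> \<le> root_const d * (l * real H ^ Suc d + real H ^ d)"
  proof (intro card_bounded_height_roots_le H \<open>0 \<le> l\<close>)
    have "\<bar>inverse x\<bar> \<le> 1" if "x \<in> I" for x
      using I[OF that] k by (simp add: inverse_le_1_iff)
    then have "- 1 \<le> inverse x \<and> inverse x \<le> 1" if "x \<in> I" for x
      using that by (simp only: abs_le_iff) (metis minus_le_iff)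
    then show "inverse ` I \<subseteq> {-1..1}"
      by auto
  qed (use diam in auto)
  finally show ?thesis by simp
qed

text \<open>Each new term is at most \<open>1 / n - 1 / (n + 1)\<close>, so the sum
  telescopes.\<close>

lemma sum_inverse_squares_le:
  assumes "1 \<le> n"
  shows "(\<Sum>k=1..n. 1 / (real k)\<^sup>2) \<le> 2 - 1 / real n"
  using assms
proof (induction n rule: dec_induct)
  case (step n)
  have "1 / (real (Suc n))\<^sup>2 \<le> 1 / real n - 1 / real (Suc n)"
  proof -
    have "1 / (real (Suc n))\<^sup>2 \<le> 1 / (real n * real (Suc n))"
      using step(1) by (intro divide_left_mono) (auto simp: power2_eq_square)
    also have "\<dots> = 1 / real n - 1 / real (Suc n)"
      using step(1) by (simp add: field_simps)
    finally show ?thesis .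
  qed
  then show ?case using step by simp
qed simp

lemma card_bounded_height_roots_Un_le:
  "card (bounded_height_roots d H (I \<union> I'))
    \<le> card (bounded_height_roots d H I) + card (bounded_height_roots d H I')"
  by (simp add: bounded_height_roots_Un card_Un_le)

lemma card_bounded_height_roots_shift:
  assumes H: "1 \<le> H" and k: "1 \<le> k" and I: "\<And>x. x \<in> I \<Longrightarrow> k \<le> \<bar>x\<bar>" and "0 \<le> l"
    and diam: "\<And>x y. x \<in> I \<Longrightarrow> y \<in> I \<Longrightarrow> \<bar>x - y\<bar> \<le> l"
  shows "card (bounded_height_roots d H I) \<le> root_const d * (l / k\<^sup>2 * real H ^ Suc d + real H ^ d)"
proof (intro card_bounded_height_roots_far[OF H k I])
  show "0 \<le> l / k\<^sup>2" using \<open>0 \<le> l\<close> by simp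
  fix x y assume xy: "x \<in> I" "y \<in> I"
  have pos: "0 < \<bar>x\<bar>" "0 < \<bar>y\<bar>" using I xy k by force+
  then have "inverse x - inverse y = (y - x) / (x * y)"
    by (auto simp: field_simps)
  then have "\<bar>inverse x - inverse y\<bar> = \<bar>x - y\<bar> / (\<bar>x\<bar> * \<bar>y\<bar>)"
    by (simp add: abs_mult abs_minus_commute)
  also have "\<dots> \<le> l / (k * k)"
    using diam[OF xy] I[OF xy(1)] I[OF xy(2)] k by (intro frac_le mult_mono) auto
  finally show "\<bar>inverse x - inverse y\<bar> \<le> l / k\<^sup>2"
    by (simp add: power2_eq_square)
qed

text \<open>Inversion contracts the translate of \<open>c\<close> by \<open>k\<close> by a factor \<open>k\<^sup>2\<close>. Translates with
  \<open>\<bar>k\<bar>\<close> up to \<open>sqrt H\<close> are counted separately, and the farther ones together, since their inverses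
  lie within \<open>1 / sqrt H\<close> of 0.\<close>

lemma card_bounded_height_roots_frac_le:
  assumes H: "1 \<le> H" and c: "c \<subseteq> {0..1}" and l: "0 \<le> l"
    and diam: "\<And>x y. x \<in> c \<Longrightarrow> y \<in> c \<Longrightarrow> \<bar>x - y\<bar> \<le> l"
  shows "card (bounded_height_roots d H {\<alpha>. frac \<alpha> \<in> c})
    \<le> 7 * root_const d * real H ^ Suc d * (l + 1 / sqrt (real H))"
proof -
  define K where "K = root_const d"
  have K: "0 < K" by (simp add: K_def root_const_pos)
  define I where "I n = {\<alpha>. \<lfloor>\<alpha>\<rfloor> = n \<and> frac \<alpha> \<in> c}" for n
  define N where "N S = card (bounded_height_roots d H S)" for S
  \<comment> \<open>The cutoff near \<open>sqrt H\<close> balances two costs: about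
    \<open>T * H ^ d\<close> from the error terms of the separate translates, and about
    \<open>H ^ (d + 1) / T\<close> from the far points.\<close>
  define T where "T = nat \<lfloor>sqrt (real H)\<rfloor>"
  have T: "real T \<le> sqrt (real H)" "sqrt (real H) < real T + 1" "1 \<le> T" and sqrtH: "1 \<le> sqrt (real H)"
  proof -
    show "1 \<le> sqrt (real H)" using H by simp
    then have "1 \<le> \<lfloor>sqrt (real H)\<rfloor>" by simp
    then show "real T \<le> sqrt (real H)" "sqrt (real H) < real T + 1" "1 \<le> T"
      unfolding T_def by linarith+
  qed
  have diamI: "\<bar>x - y\<bar> \<le> l" if "x \<in> I n" "y \<in> I n" for x y n
    using diam[of "frac x" "frac y"] that by (auto simp: I_def frac_def)
  have I_bound: "real_of_int n \<le> x \<and> x < real_of_int n + 1" if "x \<in> I n" for x n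
    using that unfolding I_def by auto
  \<comment> \<open>These two translates lie in [-1, 1], so no inversion is involved.\<close>
  have near: "N (I n) \<le> K * (l * real H ^ Suc d + real H ^ d)" if "n = 0 \<or> n = -1" for n
    unfolding N_def K_def using I_bound[of _ n] that
    by (intro card_bounded_height_roots_le H l diamI) force+
  \<comment> \<open>The translates by \<open>k\<close> and by \<open>- k - 1\<close> are paired
    because both consist of points of absolute value at least \<open>k\<close>.\<close>
  have mid: "N (I (int k) \<union> I (- int k - 1)) \<le> 2 * (K * (l / (real k)\<^sup>2 * real H ^ Suc d + real H ^ d))"
    if "1 \<le> k" for k
  proof -
    have *: "real (N (I n)) \<le> K * (l / (real k)\<^sup>2 * real H ^ Suc d + real H ^ d)"
      if n: "n = int k \<or> n = - int k - 1" for n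
      unfolding N_def K_def
    proof (intro card_bounded_height_roots_shift H l diamI)
      show "real k \<le> \<bar>x\<bar>" if "x \<in> I n" for x
        using I_bound[OF that] n by auto
    qed (use \<open>1 \<le> k\<close> in auto)
    have "real (N (I (int k))) + real (N (I (- int k - 1)))
        \<le> 2 * (K * (l / (real k)\<^sup>2 * real H ^ Suc d + real H ^ d))"
      using add_mono[OF *[OF disjI1[OF refl]] *[OF disjI2[OF refl]]] by (simp only: mult_2)
    moreover have "N (I (int k) \<union> I (- int k - 1)) \<le> N (I (int k)) + N (I (- int k - 1))"
      unfolding N_def by (rule card_bounded_height_roots_Un_le)
    ultimately show ?thesis by linarith
  qed
  define F where "F = {\<alpha> :: real. real T + 1 \<le> \<bar>\<alpha>\<bar>}"
  have far: "N F \<le> K * (2 / sqrt (real H) * real H ^ Suc d + real H ^ d)"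
    unfolding N_def K_def
  proof (intro card_bounded_height_roots_far[OF H, where k = "real T + 1"])
    fix x y assume xy: "x \<in> F" "y \<in> F"
    have *: "\<bar>inverse z\<bar> \<le> 1 / sqrt (real H)" if "z \<in> F" for z
    proof -
      have "1 / \<bar>z\<bar> \<le> 1 / sqrt (real H)"
        using that T(2) sqrtH by (intro divide_left_mono) (auto simp: F_def intro!: mult_pos_pos)
      then show ?thesis by (simp add: inverse_eq_divide)
    qed
    show "\<bar>inverse x - inverse y\<bar> \<le> 2 / sqrt (real H)"
    proof -
      have "\<bar>inverse x - inverse y\<bar> \<le> \<bar>inverse x\<bar> + \<bar>inverse y\<bar>"
        by (rule abs_triangle_ineq4)
      also have "\<dots> \<le> 1 / sqrt (real H) + 1 / sqrt (real H)"
        using xy by (intro add_mono *)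
      finally show ?thesis by simp
    qed
  qed (auto simp: F_def)
  have cover: "{\<alpha>. frac \<alpha> \<in> c} \<subseteq> (I 0 \<union> I (-1)) \<union> ((\<Union>k\<in>{1..T}. I (int k) \<union> I (- int k - 1)) \<union> F)"
  proof
    fix \<alpha> :: real assume \<alpha>: "\<alpha> \<in> {\<alpha>. frac \<alpha> \<in> c}"
    define n where "n = \<lfloor>\<alpha>\<rfloor>"
    have In: "\<alpha> \<in> I n" using \<alpha> by (simp add: I_def n_def)
    consider "n = 0" | "n = -1" | "1 \<le> n" "n \<le> int T" | "n \<le> -2" "- int T - 1 \<le> n"
      | "int T + 1 \<le> n" | "n \<le> - int T - 2" by linarith
    then show "\<alpha> \<in> (I 0 \<union> I (-1)) \<union> ((\<Union>k\<in>{1..T}. I (int k) \<union> I (- int k - 1)) \<union> F)"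
    proof cases
      case 3
      then show ?thesis using In by (auto intro!: bexI[of _ "nat n"])
    next
      case 4
      then show ?thesis using In by (auto intro!: bexI[of _ "nat (- n - 1)"])
    next
      case 5
      then have "real T + 1 \<le> real_of_int n" by linarith
      then show ?thesis using I_bound[OF In] by (auto simp: F_def)
    next
      case 6
      then have "real_of_int n \<le> - real T - 2" by linarith
      then show ?thesis using I_bound[OF In] by (auto simp: F_def)
    qed (use In in auto)
  qed
  have "N {\<alpha>. frac \<alpha> \<in> c}
      \<le> N ((I 0 \<union> I (-1)) \<union> ((\<Union>k\<in>{1..T}. I (int k) \<union> I (- int k - 1)) \<union> F))"
    unfolding N_def by (intro card_mono finite_bounded_height_roots bounded_height_roots_mono cover)
  also have "\<dots> \<le> N (I 0) + N (I (-1)) + (N (\<Union>k\<in>{1..T}. I (int k) \<union> I (- int k - 1)) + N F)"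
    unfolding N_def
    by (intro order_trans[OF card_bounded_height_roots_Un_le] add_mono order_refl)
  also have "N (\<Union>k\<in>{1..T}. I (int k) \<union> I (- int k - 1)) \<le> (\<Sum>k=1..T. N (I (int k) \<union> I (- int k - 1)))"
    unfolding N_def bounded_height_roots_UNION by (intro card_UN_le) auto
  finally have "N {\<alpha>. frac \<alpha> \<in> c}
      \<le> N (I 0) + N (I (-1)) + ((\<Sum>k=1..T. N (I (int k) \<union> I (- int k - 1))) + N F)"
    by simp
  then have "real (N {\<alpha>. frac \<alpha> \<in> c})
      \<le> real (N (I 0)) + real (N (I (-1))) + ((\<Sum>k=1..T. real (N (I (int k) \<union> I (- int k - 1)))) + real (N F))"
    by (simp only: of_nat_add[symmetric] of_nat_sum[symmetric] of_nat_le_iff)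
  also have "\<dots> \<le> K * (l * real H ^ Suc d + real H ^ d) + K * (l * real H ^ Suc d + real H ^ d)
      + ((\<Sum>k=1..T. 2 * (K * (l / (real k)\<^sup>2 * real H ^ Suc d + real H ^ d)))
        + K * (2 / sqrt (real H) * real H ^ Suc d + real H ^ d))"
    using near mid far by (intro add_mono sum_mono) auto
  also have "(\<Sum>k=1..T. 2 * (K * (l / (real k)\<^sup>2 * real H ^ Suc d + real H ^ d)))
      = 2 * K * l * real H ^ Suc d * (\<Sum>k=1..T. 1 / (real k)\<^sup>2) + 2 * K * real T * real H ^ d"
    by (simp add: sum_distrib_left sum.distrib algebra_simps)
  \<comment> \<open>The inverse squares sum to at most 2, so the length \<open>l\<close> enters with
    a bounded factor although the number of translates grows with \<open>H\<close>.\<close>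
  also have "\<dots> \<le> 2 * K * l * real H ^ Suc d * 2 + 2 * K * sqrt (real H) * real H ^ d"
    using sum_inverse_squares_le[OF T(3)] T(1) K l
    by (intro add_mono mult_left_mono mult_right_mono) (auto intro: order_trans)
  finally have "real (N {\<alpha>. frac \<alpha> \<in> c})
      \<le> K * (6 * l * real H ^ Suc d + 2 / sqrt (real H) * real H ^ Suc d
          + (3 + 2 * sqrt (real H)) * real H ^ d)"
    by (simp add: algebra_simps)
  \<comment> \<open>Writing \<open>sqrt H\<close> as \<open>H / sqrt H\<close> turns
    \<open>sqrt H * H ^ d\<close> into \<open>H ^ Suc d / sqrt H\<close>; the coefficients 2 and 5
    then add up to 7.\<close>
  also have "\<dots> \<le> K * (7 * l * real H ^ Suc d + 2 / sqrt (real H) * real H ^ Suc d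
          + 5 / sqrt (real H) * real H ^ Suc d)"
  proof (intro mult_left_mono add_mono mult_right_mono)
    have "(3 + 2 * sqrt (real H)) * real H ^ d \<le> 5 * sqrt (real H) * real H ^ d"
      using sqrtH by (intro mult_right_mono) auto
    also have "\<dots> = 5 * (real H / sqrt (real H)) * real H ^ d"
      by (simp add: real_div_sqrt)
    also have "\<dots> = 5 / sqrt (real H) * real H ^ Suc d"
      by (simp only: power_Suc times_divide_eq_left times_divide_eq_right mult.assoc)
    finally show "(3 + 2 * sqrt (real H)) * real H ^ d \<le> 5 / sqrt (real H) * real H ^ Suc d" .
  qed (use K l in auto)
  also have "\<dots> = 7 * K * real H ^ Suc d * (l + 1 / sqrt (real H))"
    by (simp add: algebra_simps)
  finally show ?thesis
    by (simp add: N_def K_def)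
qed

section \<open>A lower bound for the number of algebraic numbers\<close>

text \<open>At the least index \<open>i\<close> with \<open>coeff r i\<close> odd, all but one
  summand of the product coefficient are even, so \<open>coeff p i\<close> is odd; but
  \<open>i \<le> degree r < d\<close>.\<close>

lemma eisenstein_at_2_aux:
  fixes p q r :: "int poly"
  assumes "p = q * r" "odd (coeff q 0)" "even (coeff r 0)" "odd (lead_coeff r)" "degree r < d"
    and ev: "\<And>i. i < d \<Longrightarrow> even (coeff p i)"
  shows False
proof -
  define i where "i = (LEAST i. odd (coeff r i))"
  have i: "odd (coeff r i)" "i \<le> degree r"
    unfolding i_def using assms(4) by (rule LeastI, rule Least_le)
  have less: "even (coeff r j)" if "j < i" for j
    using that not_less_Least unfolding i_def by blast
  have "coeff p i = coeff q 0 * coeff r i + (\<Sum>j\<in>{..i} - {0}. coeff q j * coeff r (i - j))"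
    by (simp add: assms(1) coeff_mult sum.remove[of "{..i}" 0])
  moreover have "even (\<Sum>j\<in>{..i} - {0}. coeff q j * coeff r (i - j))"
    using less by (intro dvd_sum) auto
  ultimately have "odd (coeff p i)"
    using assms(2) i by simp
  then show False
    using ev[of i] i(2) assms(5) by simp
qed

text \<open>Take an integer polynomial of least degree vanishing at \<open>\<alpha>\<close>. By
  Gauss's lemma its primitive part divides \<open>p\<close> over the integers, and Eisenstein's
  criterion excludes a proper factor.\<close>

lemma primitive_min_poly_eisenstein_at_2:
  assumes deg: "degree p = d" "0 < d" and cont: "content p = 1" and root: "ipoly p \<alpha> = 0"
    and lead: "odd (lead_coeff p)" and ev: "\<And>i. i < d \<Longrightarrow> even (coeff p i)"
    and four: "\<not> 4 dvd coeff p 0"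
  shows "primitive_min_poly p \<alpha>"
proof -
  have p0: "p \<noteq> 0" using cont by auto
  obtain q where q: "q \<noteq> 0" "ipoly q \<alpha> = 0"
    and least: "\<And>q'. q' \<noteq> 0 \<Longrightarrow> ipoly q' \<alpha> = 0 \<Longrightarrow> degree q \<le> degree q'"
    using ex_has_least_nat[of "\<lambda>q. q \<noteq> 0 \<and> ipoly q \<alpha> = 0" p degree] p0 root by blast
  define q0 where "q0 = primitive_part q"
  have q_eq: "q = smult (content q) q0"
    by (simp add: q0_def)
  have q0: "q0 \<noteq> 0" "content q0 = 1" "degree q0 = degree q"
    using q(1) by (simp_all add: q0_def)
  have q0_root: "ipoly q0 \<alpha> = 0"
    using q arg_cong[OF q_eq, of "\<lambda>q. ipoly q \<alpha>"] by (simp add: ipoly_smult)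
  obtain a r s where a: "a \<noteq> 0" and eq: "smult a p = q0 * r + s" and s: "s = 0 \<or> degree s < degree q0"
    using pseudo_mod[OF q0(1), of p] by blast
  have "ipoly s \<alpha> = 0"
    using arg_cong[OF eq, of "\<lambda>q. ipoly q \<alpha>"] root q0_root
    by (simp add: ipoly_smult ipoly_add ipoly_mult)
  then have "s = 0"
    using s least[of s] q0(3) by fastforce
  then have eq': "smult a p = q0 * r" using eq by simp
  \<comment> \<open>Pseudo-division introduced the multiplier \<open>a\<close>. Since contents
    multiply, \<open>r\<close> has content \<open>\<bar>a\<bar>\<close>; dividing it out leaves a
    factorization of \<open>p\<close> itself, with the sign of \<open>a\<close> absorbed in
    \<open>r'\<close>.\<close>
  have "content r = \<bar>a\<bar>"
    using arg_cong[OF eq', of content] cont q0(2) by (simp add: content_mult)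
  then have r: "r = smult \<bar>a\<bar> (primitive_part r)"
    by (metis content_times_primitive_part)
  define r' where "r' = smult (sgn a) (primitive_part r)"
  have "smult a p = smult a (q0 * r')"
    unfolding eq' by (subst r) (simp add: r'_def mult_sgn_abs abs_sgn mult.commute)
  then have p_eq: "p = q0 * r'"
    using a by (metis smult_cancel)
  have "d \<le> degree q0"
  proof (rule ccontr)
    assume less: "\<not> d \<le> degree q0"
    have r'0: "r' \<noteq> 0" using p_eq p0 by auto
    have "degree p = degree q0 + degree r'"
      unfolding p_eq by (intro degree_mult_eq q0(1) r'0)
    moreover have "degree q0 \<noteq> 0"
    proof
      assume "degree q0 = 0"
      then obtain c where "q0 = [:c:]" by (rule degree_eq_zeroE)
      then show False using q0 q0_root by (simp add: map_poly_pCons)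
    qed
    ultimately have deg_r': "degree r' < d" using deg by simp
    have odd_lead: "odd (lead_coeff q0)" "odd (lead_coeff r')"
      using lead unfolding p_eq by (simp_all add: lead_coeff_mult)
    have c0: "coeff p 0 = coeff q0 0 * coeff r' 0"
      unfolding p_eq by (simp add: coeff_mult_0)
    then have "even (coeff q0 0) \<or> even (coeff r' 0)"
      using ev[of 0] deg(2) by simp
    \<comment> \<open>Two even constant coefficients would make \<open>coeff p 0\<close> divisible
      by 4. So exactly one factor has an even constant coefficient, and that factor plays the part
      of \<open>r\<close> in \<open>eisenstein_at_2_aux\<close>.\<close>
    moreover have "\<not> (even (coeff q0 0) \<and> even (coeff r' 0))"
      using four mult_dvd_mono[of 2 "coeff q0 0" 2 "coeff r' 0"] c0 by auto
    ultimately consider "odd (coeff q0 0)" "even (coeff r' 0)" | "odd (coeff r' 0)" "even (coeff q0 0)"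
      by blast
    then show False
    proof cases
      case 1
      then show False
        using eisenstein_at_2_aux[OF p_eq] odd_lead deg_r' ev by blast
    next
      case 2
      have "p = r' * q0" by (simp add: p_eq mult.commute)
      then show False
        using 2 eisenstein_at_2_aux odd_lead less ev by (metis not_le)
    qed
  qed
  then show ?thesis
    unfolding primitive_min_poly_def using p0 cont root deg q0(3) least by fastforce
qed

text \<open>Cross-multiplying by the leading coefficients cancels the top terms, so the difference
  is 0 by minimality of the degree; comparing contents then equates the leading coefficients. This
  makes the choice of one root per polynomial injective.\<close>

lemma primitive_min_poly_unique:
  assumes p: "primitive_min_poly p \<alpha>" and q: "primitive_min_poly q \<alpha>"
    and pos: "0 < lead_coeff p" "0 < lead_coeff q"
  shows "p = q"
proof -
  have deg: "degree p = degree q"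
    using p q unfolding primitive_min_poly_def by (metis antisym)
  define s where "s = smult (lead_coeff q) p - smult (lead_coeff p) q"
  have "ipoly s \<alpha> = 0"
    using p q by (simp add: s_def ipoly_diff ipoly_smult primitive_min_poly_def)
  have "s = 0"
  proof (rule ccontr)
    assume "s \<noteq> 0"
    have "degree s \<le> degree p"
      unfolding s_def using deg by (intro degree_diff_le) auto
    moreover have "coeff s (degree p) = 0"
      using deg by (simp add: s_def)
    ultimately have "degree s < degree p"
      using \<open>s \<noteq> 0\<close> by (metis le_neq_implies_less leading_coeff_0_iff)
    then show False
      using p \<open>s \<noteq> 0\<close> \<open>ipoly s \<alpha> = 0\<close> unfolding primitive_min_poly_def by fastforce
  qed
  then have eq: "smult (lead_coeff q) p = smult (lead_coeff p) q"
    by (simp add: s_def)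
  have "lead_coeff q = lead_coeff p"
    using arg_cong[OF eq, of content] p q pos by (simp add: primitive_min_poly_def)
  then show ?thesis
    using eq pos by (metis less_irrefl smult_cancel)
qed

lemma alg_numbers_subset: "alg_numbers d H \<subseteq> bounded_height_roots d H UNIV"
proof
  fix \<alpha> assume "\<alpha> \<in> alg_numbers d H"
  then obtain p where p: "primitive_min_poly p \<alpha>" "degree p = d" "naive_height p \<le> int H"
    by (auto simp: alg_numbers_def)
  have "\<bar>coeff p i\<bar> \<le> int H" if "i \<le> d" for i
    using p that by (auto simp: naive_height_def)
  then have "p \<in> poly_box {- int H..int H} (Suc d)"
    using p(2) by (simp add: poly_box_def abs_le_iff coeff_eq_0 minus_le_iff)
  then show "\<alpha> \<in> bounded_height_roots d H UNIV"
    using p(1) by (auto simp: bounded_height_roots_def primitive_min_poly_def)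
qed

lemma finite_alg_numbers: "finite (alg_numbers d H)"
  using alg_numbers_subset finite_bounded_height_roots by (rule finite_subset)

section \<open>Coprime pairs and the polynomials built from them\<close>

lemma card_multiples_le: "real (card {x \<in> {1..N}. m dvd x}) \<le> real N / real m"
\<comment> \<open>For \<open>m = 0\<close> both sides are 0: no positive number is a multiple of 0,
  and division by 0 gives 0.\<close>
proof (cases "m = 0")
  case False
  have "{x \<in> {1..N}. m dvd x} \<subseteq> (*) m ` {1..N div m}"
  proof
    fix x assume "x \<in> {x \<in> {1..N}. m dvd x}"
    then obtain k where "x = m * k" "1 \<le> x" "x \<le> N" by auto
    moreover from this False have "1 \<le> k" "k \<le> N div m"
      by (auto simp: less_eq_div_iff_mult_less_eq mult.commute Suc_le_eq intro!: Nat.gr0I)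
    ultimately show "x \<in> (*) m ` {1..N div m}" by auto
  qed
  then have "card {x \<in> {1..N}. m dvd x} \<le> card {1..N div m}"
    by (intro surj_card_le) auto
  then have "real (card {x \<in> {1..N}. m dvd x}) \<le> real (N div m)" by simp
  also have "\<dots> \<le> real N / real m" by (rule of_nat_div_le_of_nat)
  finally show ?thesis .
qed (auto simp: card_eq_0_iff)

text \<open>The square of \<open>2 * j + 1\<close> exceeds \<open>4 * j * (j + 1)\<close>, so each
  term is below a quarter of the telescoping difference \<open>1 / j - 1 / (j + 1)\<close>.\<close>

lemma sum_odd_inverse_squares_le:
  "(\<Sum>j=1..n. 1 / (real (2 * j + 1))\<^sup>2) \<le> 1 / 4 - 1 / (4 * real (n + 1))"
proof (induction n)
  case (Suc n)
  have "1 / (real (2 * Suc n + 1))\<^sup>2 \<le> 1 / (4 * (real (n + 1) * real (n + 2)))"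
    by (intro divide_left_mono mult_pos_pos zero_less_power) (simp_all add: power2_eq_square algebra_simps)
  also have "\<dots> = 1 / (4 * real (n + 1)) - 1 / (4 * real (Suc n + 1))"
    by (simp add: divide_simps) (simp add: algebra_simps)
  finally show ?case using Suc by simp
qed simp

definition coprime_pairs :: "nat \<Rightarrow> (nat \<times> nat) set" where
  "coprime_pairs N = {(x, y) \<in> {1..N} \<times> {1..N}. odd y \<and> coprime x y}"

text \<open>A pair that is not coprime has an odd common divisor \<open>m \<ge> 3\<close>, and the sum of \<open>1 / m\<^sup>2\<close> over
  these is at most \<open>1 / 4\<close>, while half of all pairs have \<open>y\<close> odd.\<close>

lemma card_coprime_pairs_ge: "(real N)\<^sup>2 / 4 \<le> real (card (coprime_pairs N))"
proof -
  define Od where "Od = {y \<in> {1..N}. odd y}"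
  define B where "B = {(x, y) \<in> {1..N} \<times> Od. \<not> coprime x y}"
  define M where "M m = {x \<in> {1..N}. m dvd x}" for m
  have "N \<le> 2 * card ((\<lambda>j. 2 * j + 1) ` {0..<(N + 1) div 2})"
    by (subst card_image) (auto simp: inj_on_def)
  also have "\<dots> \<le> 2 * card Od"
    by (intro mult_left_mono card_mono) (auto simp: Od_def)
  finally have Od: "real N / 2 \<le> real (card Od)" by linarith
  have "B \<subseteq> (\<Union>j\<in>{1..N}. M (2 * j + 1) \<times> M (2 * j + 1))"
  proof
    fix z assume "z \<in> B"
    then obtain x y where z: "z = (x, y)" "x \<in> {1..N}" "y \<in> {1..N}" "odd y" "\<not> coprime x y"
      by (auto simp: B_def Od_def)
    \<comment> \<open>As a divisor of the odd \<open>y\<close> the gcd is odd, hence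
      \<open>2 * j + 1\<close>, and \<open>j\<close> is positive because the gcd is not 1.\<close>
    have "odd (gcd x y)" using z(4) by (meson dvd_trans gcd_dvd2)
    then obtain j where j: "gcd x y = 2 * j + 1" by (elim oddE)
    have "j \<noteq> 0" using j z(5) by (auto simp: coprime_iff_gcd_eq_1)
    moreover have "j \<le> N" using j z(2) gcd_le1_nat[of x y] by simp
    moreover have "2 * j + 1 dvd x" "2 * j + 1 dvd y" unfolding j[symmetric] by simp_all
    ultimately show "z \<in> (\<Union>j\<in>{1..N}. M (2 * j + 1) \<times> M (2 * j + 1))"
      using z by (auto simp: M_def intro!: bexI[of _ j])
  qed
  then have "card B \<le> card (\<Union>j\<in>{1..N}. M (2 * j + 1) \<times> M (2 * j + 1))"
    by (intro card_mono) (auto simp: M_def)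
  also have "\<dots> \<le> (\<Sum>j=1..N. card (M (2 * j + 1) \<times> M (2 * j + 1)))"
    by (intro card_UN_le) auto
  finally have "real (card B) \<le> real (\<Sum>j=1..N. card (M (2 * j + 1) \<times> M (2 * j + 1)))"
    by (simp only: of_nat_le_iff)
  also have "\<dots> = (\<Sum>j=1..N. real (card (M (2 * j + 1))) * real (card (M (2 * j + 1))))"
    by (simp add: card_cartesian_product)
  also have "\<dots> \<le> (\<Sum>j=1..N. real N / real (2 * j + 1) * (real N / real (2 * j + 1)))"
    unfolding M_def by (intro sum_mono mult_mono card_multiples_le) auto
  also have "\<dots> = (real N)\<^sup>2 * (\<Sum>j=1..N. 1 / (real (2 * j + 1))\<^sup>2)"
    by (simp add: sum_distrib_left power2_eq_square)
  also have "\<dots> \<le> (real N)\<^sup>2 * (1 / 4)"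
  proof (rule mult_left_mono)
    have "1 / 4 - 1 / (4 * real (N + 1)) \<le> 1 / 4" by simp
    then show "(\<Sum>j=1..N. 1 / (real (2 * j + 1))\<^sup>2) \<le> 1 / 4"
      by (rule order_trans[OF sum_odd_inverse_squares_le])
  qed simp
  finally have B: "real (card B) \<le> (real N)\<^sup>2 / 4" by simp
  have "(real N)\<^sup>2 / 2 = real N * (real N / 2)"
    by (simp add: power2_eq_square)
  also have "\<dots> \<le> real N * real (card Od)"
    using Od by (intro mult_left_mono) auto
  also have "\<dots> = real (card ({1..N} \<times> Od))"
    by (simp add: card_cartesian_product)
  also have "{1..N} \<times> Od = coprime_pairs N \<union> B"
    by (auto simp: coprime_pairs_def B_def Od_def)
  also have "real (card (coprime_pairs N \<union> B)) \<le> real (card (coprime_pairs N)) + real (card B)"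
    using card_Un_le[of "coprime_pairs N" B] by linarith
  finally show ?thesis using B by simp
qed

text \<open>The outer coefficients \<open>-2y\<close> and \<open>3y + 2x\<close> are coprime when \<open>x\<close> and \<open>y\<close> are coprime and \<open>y\<close>
  is odd, so the polynomial is primitive and Eisenstein at 2. Nonnegativity of \<open>q\<close> together with
  \<open>2y < 3y + 2x\<close> forces a sign change between 0 and 1.\<close>

definition eisenstein_poly :: "nat \<Rightarrow> (nat \<times> nat) \<times> int poly \<Rightarrow> int poly" where
  "eisenstein_poly e = (\<lambda>((x, y), q). pCons (- 2 * int y) (smult 2 q + monom (int (3 * y + 2 * x)) e))"

lemma coeff_eisenstein_poly:
  "coeff (eisenstein_poly e ((x, y), q)) i =
    (case i of 0 \<Rightarrow> - 2 * int y | Suc j \<Rightarrow> 2 * coeff q j + (if j = e then int (3 * y + 2 * x) else 0))"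
  by (auto simp: eisenstein_poly_def coeff_pCons split: nat.splits)

lemma eisenstein_poly_props:
  assumes xy: "(x, y) \<in> coprime_pairs N" and q: "q \<in> poly_box {0..int N} e"
  defines "p \<equiv> eisenstein_poly e ((x, y), q)"
  shows "degree p = Suc e" "lead_coeff p = int (3 * y + 2 * x)" "naive_height p \<le> int (5 * N)"
    "\<exists>\<alpha>\<in>{0..1}. primitive_min_poly p \<alpha>"
proof -
  have y: "1 \<le> y" "y \<le> N" "odd y" "coprime x y" and x: "1 \<le> x" "x \<le> N"
    using xy by (auto simp: coprime_pairs_def)
  have qe: "coeff q i = 0" if "e \<le> i" for i
    using q that by (auto simp: poly_box_def)
  have qr: "0 \<le> coeff q i \<and> coeff q i \<le> int N" for i
    using q qe[of i] by (cases "i < e") (auto simp: poly_box_def)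
  show deg: "degree p = Suc e"
  proof (rule antisym)
    show "degree p \<le> Suc e"
      by (rule degree_le) (auto simp: p_def coeff_eisenstein_poly qe split: nat.splits)
    show "Suc e \<le> degree p"
      using y by (intro le_degree) (simp add: p_def coeff_eisenstein_poly qe)
  qed
  show lead: "lead_coeff p = int (3 * y + 2 * x)"
    unfolding deg by (simp add: p_def coeff_eisenstein_poly qe)
  \<comment> \<open>The leading coefficient is at most \<open>3 * N + 2 * N\<close>; all others are
    at most \<open>2 * N\<close> in absolute value.\<close>
  have "\<bar>coeff p i\<bar> \<le> int (5 * N)" for i
    using qr qe x y by (auto simp: p_def coeff_eisenstein_poly abs_le_iff split: nat.splits)
      (smt (verit) qr)+
  then show "naive_height p \<le> int (5 * N)"
    by (auto simp: naive_height_def)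
  have "ipoly p 0 < 0"
    using y by (simp add: p_def eisenstein_poly_def ipoly_pCons)
  moreover have "0 < ipoly p 1"
  proof -
    have "0 \<le> ipoly q 1"
      using qr by (subst ipoly_altdef[of e]) (auto simp: qe intro!: sum_nonneg)
    then show ?thesis
      using y by (simp add: p_def eisenstein_poly_def ipoly_pCons ipoly_add ipoly_smult ipoly_monom)
  qed
  ultimately obtain \<alpha> where \<alpha>: "0 < \<alpha>" "\<alpha> < 1" "ipoly p \<alpha> = 0"
    using poly_IVT_pos[of 0 1 "map_poly real_of_int p"] by auto
  have c0: "coeff p 0 = - 2 * int y"
    by (simp add: p_def coeff_eisenstein_poly)
  have "content p = 1"
  proof -
    have "content p dvd 2 * int y"
      using content_dvd_coeff[of p 0] unfolding c0 by simp
    moreover have "content p dvd int (3 * y + 2 * x)"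
      using content_dvd_coeff[of p "degree p"] unfolding lead .
    moreover have "coprime (2 * int y) (int (3 * y + 2 * x))"
    proof -
      have "coprime (2 * y) (3 * y + 2 * x)"
      proof -
        \<comment> \<open>Modulo \<open>y\<close> the second argument is \<open>2 * x\<close>, which
          is coprime to \<open>y\<close> because \<open>y\<close> is odd and coprime to
          \<open>x\<close>.\<close>
        have "coprime y (2 * x + 3 * y)"
          using y by (metis coprime_commute coprime_mult_left_iff coprime_left_2_iff_odd
              gcd_add_mult coprime_iff_gcd_eq_1 add.commute)
        moreover have "coprime 2 (3 * y + 2 * x)" using y by simp
        ultimately show ?thesis by (simp add: add.commute)
      qed
      then show ?thesis
        by (metis coprime_int_iff of_nat_mult of_nat_numeral)
    qed
    ultimately have "is_unit (content p)"
      by (meson coprime_common_divisor)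
    then show ?thesis
      by (metis is_unit_normalize normalize_content)
  qed
  moreover have "even (coeff p i)" if "i < Suc e" for i
    using that by (auto simp: p_def coeff_eisenstein_poly split: nat.splits)
  moreover have "\<not> 4 dvd coeff p 0"
    unfolding c0 using y(3) by presburger
  moreover have "odd (lead_coeff p)"
    unfolding lead using y(3) by simp
  ultimately have "primitive_min_poly p \<alpha>"
    using deg \<alpha> by (intro primitive_min_poly_eisenstein_at_2[where d = "Suc e"]) auto
  then show "\<exists>\<alpha>\<in>{0..1}. primitive_min_poly p \<alpha>"
    using \<alpha> by (intro bexI[of _ \<alpha>]) auto
qed

lemma inj_on_eisenstein_poly:
  "inj_on (eisenstein_poly e) (coprime_pairs N \<times> poly_box {0..int N} e)"
proof (rule inj_onI, clarify)
  fix x y q x' y' q'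
  assume q: "q \<in> poly_box {0..int N} e" "q' \<in> poly_box {0..int N} e"
    and eq: "eisenstein_poly e ((x, y), q) = eisenstein_poly e ((x', y'), q')"
  have y: "y = y'" and r: "smult 2 q + monom (int (3 * y + 2 * x)) e = smult 2 q' + monom (int (3 * y' + 2 * x')) e"
    using eq by (auto simp: eisenstein_poly_def)
  \<comment> \<open>Position \<open>e\<close> is empty in both \<open>q\<close> and
    \<open>q'\<close>, so the coefficient there reveals the monomial and thereby
    \<open>x\<close>.\<close>
  have "coeff q e = 0" "coeff q' e = 0" using q by (auto simp: poly_box_def)
  then have x: "x = x'"
    using arg_cong[OF r, of "\<lambda>p. coeff p e"] y by simp
  have "smult 2 q = smult 2 q'" using r x y by simp
  then have "q = q'" by (metis smult_cancel zero_neq_numeral)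
  then show "((x, y) = (x', y')) \<and> q = q'" using x y by simp
qed

text \<open>Distinct polynomials of the Eisenstein family have distinct roots, so it suffices to
  count polynomials: at least \<open>N ^ 2 / 4\<close> coprime pairs times
  \<open>N ^ (d - 1)\<close> choices of \<open>q\<close>, with \<open>N\<close> proportional to
  \<open>H\<close>.\<close>

lemma card_alg_numbers_unit_ge:
  assumes "1 \<le> d" "5 \<le> H"
  shows "real H ^ Suc d / (4 * 10 ^ Suc d) \<le> real (card (alg_numbers_unit d H))"
proof -
  obtain e where d: "d = Suc e" using assms by (cases d) auto
  \<comment> \<open>Heights reach \<open>5 * N\<close>, hence the division by 5;
    \<open>H \<ge> 5\<close> keeps \<open>N\<close> at least \<open>H / 10\<close>.\<close>
  define N where "N = H div 5"
  have N: "5 * N \<le> H" "real H / 10 \<le> real N"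
    
  proof -
    show "5 * N \<le> H" by (simp add: N_def)
    have "H \<le> 10 * N" using assms(2) unfolding N_def by presburger
    then show "real H / 10 \<le> real N" by linarith
  qed
  define D where "D = coprime_pairs N \<times> poly_box {0..int N} e"
  define P where "P = eisenstein_poly e ` D"
  define f where "f p = (SOME \<alpha>. \<alpha> \<in> {0..1} \<and> primitive_min_poly p \<alpha>)" for p
  have P: "degree p = d \<and> 0 < lead_coeff p \<and> naive_height p \<le> int H \<and> f p \<in> {0..1} \<and> primitive_min_poly p (f p)"
    if p: "p \<in> P" for p
  proof -
    obtain x y q where xyq: "p = eisenstein_poly e ((x, y), q)" "(x, y) \<in> coprime_pairs N"
        "q \<in> poly_box {0..int N} e"
      using p by (auto simp: P_def D_def)
    note props = eisenstein_poly_props[OF xyq(2,3), folded xyq(1)]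
    have "\<exists>\<alpha>. \<alpha> \<in> {0..1} \<and> primitive_min_poly p \<alpha>"
      using props(4) unfolding Bex_def .
    then have "f p \<in> {0..1} \<and> primitive_min_poly p (f p)"
      unfolding f_def by (rule someI_ex)
    moreover have "1 \<le> y" using xyq(2) by (simp add: coprime_pairs_def)
    ultimately show ?thesis
      using props(1-3) N(1) by (simp add: d)
  qed
  have "inj_on f P"
    using P by (intro inj_onI) (metis primitive_min_poly_unique)
  moreover have "f ` P \<subseteq> alg_numbers_unit d H"
    using P unfolding alg_numbers_unit_def alg_numbers_def by blast
  moreover have "finite (alg_numbers_unit d H)"
    by (simp add: alg_numbers_unit_def finite_alg_numbers)
  ultimately have "card P \<le> card (alg_numbers_unit d H)"
    by (intro card_inj_on_le)
  moreover have "card P = card (coprime_pairs N) * (N + 1) ^ e"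
    unfolding P_def D_def
    by (simp add: card_image[OF inj_on_eisenstein_poly] card_cartesian_product card_poly_box nat_add_distrib)
  ultimately have "real (card (coprime_pairs N) * (N + 1) ^ e) \<le> real (card (alg_numbers_unit d H))"
    by (simp only: of_nat_le_iff)
  moreover have "(real N)\<^sup>2 / 4 * real N ^ e \<le> real (card (coprime_pairs N)) * real (N + 1) ^ e"
    by (intro mult_mono card_coprime_pairs_ge power_mono) auto
  moreover have "(real N)\<^sup>2 / 4 * real N ^ e = real N ^ Suc d / 4"
    by (simp add: d power2_eq_square)
  moreover have "(real H / 10) ^ Suc d \<le> real N ^ Suc d"
    using N(2) by (intro power_mono) auto
  ultimately show ?thesis
    by (simp add: power_divide)
qed

section \<open>Components of the approximation sets\<close>

text \<open>The segment between two points of a connected set lies in it. Length thus serves as the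
  diameter bound of the root count.\<close>

lemma abs_diff_le_measure:
  assumes "connected c" "compact c" "x \<in> c" "y \<in> c"
  shows "\<bar>x - y\<bar> \<le> measure lebesgue (c :: real set)"
proof -
  have *: "v - u \<le> measure lebesgue c" if "u \<in> c" "v \<in> c" "u \<le> v" for u v
  proof -
    have "{u..v} \<subseteq> c" using assms(1) that by (intro connected_contains_Icc)
    then have "measure lebesgue {u..v} \<le> measure lebesgue c"
      by (intro measure_mono_fmeasurable) (auto intro: lmeasurable_compact assms)
    then show ?thesis using that by simp
  qed
  show ?thesis
    using *[OF assms(3,4)] *[OF assms(4,3)] by linarith
qed

lemma components_contain_piece:
  assumes "\<And>C. C \<in> F \<Longrightarrow> connected C" "D \<in> components (\<Union>F)"
  obtains C where "C \<in> F" "C \<noteq> {}" "C \<subseteq> D"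
proof -
  obtain x where x: "x \<in> D" using assms(2) in_components_nonempty by blast
  then obtain C where C: "C \<in> F" "x \<in> C" using assms(2) in_components_subset by blast
  then have "C \<subseteq> D"
    using x assms by (intro components_maximal[OF assms(2)]) auto
  then show ?thesis using that C by blast
qed

text \<open>Each component contains a nonempty member of \<open>F\<close>, and different components
  are disjoint, so there are no more components than members.\<close>

lemma finite_components_Union:
  assumes "finite F" and conn: "\<And>C. C \<in> F \<Longrightarrow> connected C"
  shows "finite (components (\<Union>F))"
proof -
  have "\<forall>D\<in>components (\<Union>F). \<exists>C. C \<in> F \<and> C \<noteq> {} \<and> C \<subseteq> D"
    using components_contain_piece[OF conn] by metis
  then obtain f where f: "\<forall>D\<in>components (\<Union>F). f D \<in> F \<and> f D \<noteq> {} \<and> f D \<subseteq> D"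
    by metis
  have "inj_on f (components (\<Union>F))"
  proof (rule inj_onI)
    fix D D' assume D: "D \<in> components (\<Union>F)" "D' \<in> components (\<Union>F)" "f D = f D'"
    then have "f D \<subseteq> D \<inter> D'" "f D \<noteq> {}" using f by auto
    then show "D = D'" using D components_eq by blast
  qed
  moreover have "f ` components (\<Union>F) \<subseteq> F" using f by auto
  ultimately show ?thesis using \<open>finite F\<close> inj_on_finite by blast
qed

lemma measure_eq_sum_components:
  assumes "compact (S :: real set)" "finite (components S)"
  shows "measure lebesgue S = (\<Sum>c\<in>components S. measure lebesgue c)"
proof -
  have "measure lebesgue (\<Union>(components S)) = (\<Sum>c\<in>components S. measure lebesgue c)"
    using assms pairwise_disjoint_components[of S]
    by (intro measure_Union' lmeasurable_compact) (auto intro: compact_components simp: pairwise_def disjnt_def)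
  then show ?thesis by simp
qed

text \<open>The error of an estimate for intervals is paid once per component, and there are at most
  \<open>\<bar>S\<bar> / m\<close> components if each has length at least \<open>m\<close>.\<close>

lemma card_le_by_components:
  fixes g :: "'a \<Rightarrow> real"
  assumes S: "compact S" "finite (components S)" and m: "0 < m" "\<And>c. c \<in> components S \<Longrightarrow> m \<le> measure lebesgue c"
    and A: "finite A" and "0 \<le> K" "0 \<le> e"
    and bound: "\<And>c. connected c \<Longrightarrow> compact c \<Longrightarrow> c \<subseteq> S \<Longrightarrow>
      real (card {\<alpha> \<in> A. g \<alpha> \<in> c}) \<le> K * (measure lebesgue c + e)"
  shows "real (card {\<alpha> \<in> A. g \<alpha> \<in> S}) \<le> K * measure lebesgue S * (1 + e / m)"
proof -
  have "{\<alpha> \<in> A. g \<alpha> \<in> S} = (\<Union>c\<in>components S. {\<alpha> \<in> A. g \<alpha> \<in> c})"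
    using Union_components[of S] by blast
  then have "card {\<alpha> \<in> A. g \<alpha> \<in> S} \<le> (\<Sum>c\<in>components S. card {\<alpha> \<in> A. g \<alpha> \<in> c})"
    using card_UN_le[OF S(2)] by simp
  then have "real (card {\<alpha> \<in> A. g \<alpha> \<in> S}) \<le> real (\<Sum>c\<in>components S. card {\<alpha> \<in> A. g \<alpha> \<in> c})"
    by (simp only: of_nat_le_iff)
  also have "\<dots> = (\<Sum>c\<in>components S. real (card {\<alpha> \<in> A. g \<alpha> \<in> c}))"
    by simp
  also have "\<dots> \<le> (\<Sum>c\<in>components S. K * (measure lebesgue c * (1 + e / m)))"
  proof (rule sum_mono)
    fix c assume c: "c \<in> components S"
    have "real (card {\<alpha> \<in> A. g \<alpha> \<in> c}) \<le> K * (measure lebesgue c + e)"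
      using c S by (intro bound) (auto intro: in_components_connected compact_components dest: in_components_subset)
    also have "\<dots> \<le> K * (measure lebesgue c * (1 + e / m))"
    proof (intro mult_left_mono \<open>0 \<le> K\<close>)
      have "e \<le> measure lebesgue c * (e / m)"
        using mult_right_mono[OF m(2)[OF c], of "e / m"] m(1) \<open>0 \<le> e\<close> by simp
      then show "measure lebesgue c + e \<le> measure lebesgue c * (1 + e / m)"
        by (simp add: distrib_left)
    qed
    finally show "real (card {\<alpha> \<in> A. g \<alpha> \<in> c}) \<le> K * (measure lebesgue c * (1 + e / m))" .
  qed
  also have "\<dots> = K * measure lebesgue S * (1 + e / m)"
    by (simp add: measure_eq_sum_components[OF S] sum_distrib_left sum_distrib_right mult.assoc)
  finally show ?thesis .
qed

text \<open>The intervals are not cut to [0, 1], so that the complement of \<open>J_set\<close>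
  arises from [0, 1] by removing plain closed intervals.\<close>

definition J_piece :: "(real \<Rightarrow> real) \<Rightarrow> nat \<times> nat \<Rightarrow> real set" where
  "J_piece \<Psi> = (\<lambda>(q, p). {real p / real q - \<Psi> (real q) / real q..real p / real q + \<Psi> (real q) / real q})"

definition J_index :: "nat \<Rightarrow> nat \<Rightarrow> (nat \<times> nat) set" where
  "J_index Q1 Q2 = (SIGMA q:{Q1..<Q2}. {0..q})"

lemma finite_J_index: "finite (J_index Q1 Q2)"
  by (simp add: J_index_def)

lemma J_set_eq: "J_set \<Psi> Q1 Q2 = \<Union>((\<lambda>i. J_piece \<Psi> i \<inter> {0..1}) ` J_index Q1 Q2)"
  unfolding J_set_def J_piece_def J_index_def Bstar_def by fastforce

lemma compact_J_set: "compact (J_set \<Psi> Q1 Q2)"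
  unfolding J_set_eq using finite_J_index by (intro compact_Union) (auto simp: J_piece_def)

lemma J_set_subset: "J_set \<Psi> Q1 Q2 \<subseteq> {0..1}"
  by (auto simp: J_set_eq)

lemma connected_J_piece_unit: "connected (J_piece \<Psi> i \<inter> {0..1})"
  by (auto simp: J_piece_def split: prod.splits)

lemma finite_components_J_set: "finite (components (J_set \<Psi> Q1 Q2))"
  unfolding J_set_eq using finite_J_index connected_J_piece_unit
  by (intro finite_components_Union) auto

text \<open>A component contains a whole piece around some \<open>p / q\<close>. Clipping to [0, 1]
  may remove one side of it, as for \<open>p = 0\<close>, so only half of \<open>Theta_min\<close>
  is guaranteed.\<close>

lemma component_J_set_measure_ge:
  assumes "1 \<le> Q1" "Q1 < Q2" and \<theta>: "0 < Theta_min \<Psi> Q1 Q2" "Theta_min \<Psi> Q1 Q2 < 1"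
    and D: "D \<in> components (J_set \<Psi> Q1 Q2)"
  shows "Theta_min \<Psi> Q1 Q2 / 2 \<le> measure lebesgue D"
proof -
  define t where "t = Theta_min \<Psi> Q1 Q2 / 2"
  obtain C where "C \<in> (\<lambda>i. J_piece \<Psi> i \<inter> {0..1}) ` J_index Q1 Q2" and CD: "C \<subseteq> D"
    using D connected_J_piece_unit unfolding J_set_eq
    by (elim components_contain_piece[rotated]) auto
  then obtain q p where qp: "q \<in> {Q1..<Q2}" "p \<le> q" "C = J_piece \<Psi> (q, p) \<inter> {0..1}"
    by (auto simp: J_index_def)
  have "Theta_min \<Psi> Q1 Q2 \<le> 2 * \<Psi> (real q) / real q"
    unfolding Theta_min_def using qp by (intro Min_le) auto
  then have t: "t \<le> \<Psi> (real q) / real q" by (simp add: t_def mult.commute)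
  have t01: "0 < t" "t < 1 / 2" using \<theta> by (simp_all add: t_def)
  define x where "x = real p / real q"
  have x: "0 \<le> x" "x \<le> 1" using qp assms by (auto simp: x_def)
  \<comment> \<open>A step of size \<open>t < 1 / 2\<close> towards the farther end of [0, 1] stays
    inside.\<close>
  define y where "y = (if x \<le> 1 / 2 then x + t else x - t)"
  have "x \<in> C" "y \<in> C"
    using x t t01 by (auto simp: qp J_piece_def y_def x_def[symmetric])
  then have "\<bar>x - y\<bar> \<le> measure lebesgue D"
    using CD D
    by (intro abs_diff_le_measure) (auto intro: in_components_connected compact_components[OF compact_J_set])
  then show ?thesis using t01 by (auto simp: y_def t_def split: if_splits)
qed

section \<open>The complement and its closure\<close>

lemma connected_diff_interval_cover:
  fixes S :: "real set"
  assumes "finite I" "connected S"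
  shows "\<exists>F. finite F \<and> (\<forall>C\<in>F. connected C) \<and> S - (\<Union>i\<in>I. {a i..b i}) = \<Union>F"
  using assms(1)
proof (induction I rule: finite_induct)
  case empty
  show ?case using assms(2) by (intro exI[of _ "{S}"]) auto
next
  case (insert i I)
  then obtain F where F: "finite F" "\<forall>C\<in>F. connected C" "S - (\<Union>i\<in>I. {a i..b i}) = \<Union>F"
    by blast
  \<comment> \<open>Each piece splits into its parts left and right of the removed interval. If that
    interval is empty the parts may overlap, which is harmless since \<open>F\<close> need not be
    disjoint.\<close>
  let ?F = "(\<lambda>C. C \<inter> {..<a i}) ` F \<union> (\<lambda>C. C \<inter> {b i<..}) ` F"
  have "S - (\<Union>i\<in>insert i I. {a i..b i}) = \<Union>F - {a i..b i}"
    using F(3) by auto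
  also have "\<dots> = \<Union>?F" by (auto simp: not_le)
  finally have "S - (\<Union>i\<in>insert i I. {a i..b i}) = \<Union>?F" .
  moreover have "connected C" if "C \<in> ?F" for C
  proof -
    have "is_interval C" using that F(2) by (auto simp: is_interval_connected_1[symmetric] intro!: is_interval_Int)
    then show ?thesis by (simp add: is_interval_connected_1)
  qed
  ultimately show ?case using F(1) by (intro exI[of _ ?F]) auto
qed

lemma J_complement_cover:
  "\<exists>F. finite F \<and> (\<forall>C\<in>F. connected C) \<and> {0..1} - J_set \<Psi> Q1 Q2 = \<Union>F"
proof -
  have "{0..1} - J_set \<Psi> Q1 Q2 = {0..1} - (\<Union>i\<in>J_index Q1 Q2. J_piece \<Psi> i)"
    by (auto simp: J_set_eq)
  also have "\<dots> = {0..1} - (\<Union>i\<in>J_index Q1 Q2. {real (snd i) / real (fst i) - \<Psi> (real (fst i)) / real (fst i)..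
      real (snd i) / real (fst i) + \<Psi> (real (fst i)) / real (fst i)})"
    by (simp add: J_piece_def case_prod_unfold)
  finally show ?thesis
    by (simp only:) (rule connected_diff_interval_cover[OF finite_J_index connected_Icc])
qed

text \<open>Closure commutes with finite unions and preserves connectedness. That nonempty pieces
  meet the complement itself is recorded for the positivity of component lengths.\<close>

lemma J_tilde_cover:
  "\<exists>F. finite F \<and> (\<forall>C\<in>F. connected C \<and> (C \<noteq> {} \<longrightarrow> C \<inter> ({0..1} - J_set \<Psi> Q1 Q2) \<noteq> {})) \<and>
    J_tilde \<Psi> Q1 Q2 = \<Union>F"
proof -
  obtain F where F: "finite F" "\<forall>C\<in>F. connected C" "{0..1} - J_set \<Psi> Q1 Q2 = \<Union>F"
    using J_complement_cover[of \<Psi> Q1 Q2] by (elim exE conjE)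
  have "closure (\<Union>F) = \<Union>(closure ` F)"
    using F(1) by (induction F rule: finite_induct) auto
  then have "J_tilde \<Psi> Q1 Q2 = \<Union>(closure ` F)"
    unfolding J_tilde_def F(3) .
  moreover have "connected (closure C) \<and> (closure C \<noteq> {} \<longrightarrow> closure C \<inter> ({0..1} - J_set \<Psi> Q1 Q2) \<noteq> {})"
    if C: "C \<in> F" for C
  proof (intro conjI impI)
    show "connected (closure C)" using F(2) C by (simp add: connected_imp_connected_closure)
    assume "closure C \<noteq> {}"
    then obtain x where "x \<in> C" by auto
    then have "x \<in> closure C \<inter> \<Union>F" using C closure_subset[of C] by blast
    then show "closure C \<inter> ({0..1} - J_set \<Psi> Q1 Q2) \<noteq> {}" unfolding F(3) by blast
  qed
  ultimately show ?thesis
    using F(1) by (intro exI[of _ "closure ` F"]) simp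
qed

lemma J_tilde_subset: "J_tilde \<Psi> Q1 Q2 \<subseteq> {0..1}"
  unfolding J_tilde_def by (intro closure_minimal) auto

lemma compact_J_tilde: "compact (J_tilde \<Psi> Q1 Q2)"
  unfolding compact_eq_bounded_closed
  using J_tilde_subset by (auto simp: J_tilde_def intro: bounded_subset[OF bounded_closed_interval])

lemma finite_components_J_tilde: "finite (components (J_tilde \<Psi> Q1 Q2))"
proof -
  obtain F where F: "finite F" "\<forall>C\<in>F. connected C" "J_tilde \<Psi> Q1 Q2 = \<Union>F"
    using J_tilde_cover[of \<Psi> Q1 Q2] by auto
  then show ?thesis
    using finite_components_Union[of F] by simp
qed

text \<open>A component contains a point outside the closed set \<open>J_set\<close>, and with it a
  neighbourhood of that point in [0, 1]; hence no component is a single point.\<close>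

lemma component_J_tilde_measure_pos:
  assumes D: "D \<in> components (J_tilde \<Psi> Q1 Q2)"
  shows "0 < measure lebesgue D"
proof -
  obtain F where F: "\<forall>C\<in>F. connected C \<and> (C \<noteq> {} \<longrightarrow> C \<inter> ({0..1} - J_set \<Psi> Q1 Q2) \<noteq> {})"
      "J_tilde \<Psi> Q1 Q2 = \<Union>F"
    using J_tilde_cover[of \<Psi> Q1 Q2] by (elim exE conjE)
  obtain C where "C \<in> F" "C \<noteq> {}" "C \<subseteq> D"
    using components_contain_piece[of F D] F D by auto
  with F(1) have "C \<subseteq> D" "C \<inter> ({0..1} - J_set \<Psi> Q1 Q2) \<noteq> {}" by auto
  then obtain x where x: "x \<in> D" "x \<in> {0..1}" "x \<notin> J_set \<Psi> Q1 Q2" by blast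
  have "open (- J_set \<Psi> Q1 Q2)"
    using compact_J_set by (simp add: compact_imp_closed open_Compl)
  then obtain r where r: "0 < r" "cball x r \<subseteq> - J_set \<Psi> Q1 Q2"
    using x(3) open_contains_cball by (metis ComplI)
  define W where "W = {x - r..x + r} \<inter> {0..1}"
  have "W \<subseteq> {0..1} - J_set \<Psi> Q1 Q2"
    using r(2) by (auto simp: W_def cball_eq_atLeastAtMost)
  then have "W \<subseteq> J_tilde \<Psi> Q1 Q2"
    using closure_subset unfolding J_tilde_def by blast
  moreover have "x \<in> W" using x r by (auto simp: W_def)
  ultimately have W: "W \<subseteq> D"
    using x by (intro components_maximal[OF D]) (auto simp: W_def)
  define t where "t = min r (1 / 2)"
  have t: "0 < t" "t \<le> r" "t \<le> 1 / 2" using r by (auto simp: t_def)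
  define y where "y = (if x \<le> 1 / 2 then x + t else x - t)"
  have "y \<in> W" using x t by (auto simp: W_def y_def)
  then have "\<bar>x - y\<bar> \<le> measure lebesgue D"
    using W x D
    by (intro abs_diff_le_measure) (auto intro: in_components_connected compact_components[OF compact_J_tilde])
  moreover have "0 < \<bar>x - y\<bar>" using t by (auto simp: y_def)
  ultimately show ?thesis by linarith
qed

section \<open>Proportions\<close>

fun base_error :: "alg_family \<Rightarrow> nat \<Rightarrow> real" where
  "base_error Whole_Line H = 1 / sqrt (real H)"
| "base_error Unit_Interval H = 1 / real H"

lemma base_error_nonneg: "0 \<le> base_error X H"
  by (cases X) auto

text \<open>From 5 on the logarithm is at least 1, so the logarithmic factor only enlarges the
  error.\<close>

lemma base_error_le_error_term:
  assumes "5 \<le> H"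
  shows "base_error X H \<le> error_term 1 1 X d H"
proof -
  have "exp 1 \<le> real H" using exp_le assms by linarith
  then have "1 \<le> ln (real H)" using assms by (subst ln_ge_iff) auto
  then have ln: "1 \<le> ln (real H) ^ log_exponent d" by (rule one_le_power)
  show ?thesis
  proof (cases X)
    case Whole_Line
    have "1 / sqrt (real H) = sqrt (1 / real H)" by (simp add: real_sqrt_divide)
    also have "\<dots> \<le> sqrt (ln (real H) ^ log_exponent d / real H)"
      using ln by (intro real_sqrt_le_mono divide_right_mono) auto
    finally show ?thesis using Whole_Line by simp
  next
    case Unit_Interval
    then show ?thesis using ln by (auto intro: divide_right_mono)
  qed
qed

text \<open>The 28 is 7 from the interval count times 4 from the denominator
  \<open>4 * 10 ^ Suc d\<close> in the lower bound for the family.\<close>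

definition prop_const :: "nat \<Rightarrow> real" where
  "prop_const d = 28 * root_const d * 10 ^ Suc d"

lemma prop_const_pos: "0 < prop_const d"
  by (simp add: prop_const_def root_const_pos)

text \<open>The number 1 is the only point of [0, 1] that \<open>frac\<close> moves; without it,
  reduction modulo one is the identity on the unit family.\<close>

lemma one_notin_alg_numbers:
  assumes "2 \<le> d"
  shows "1 \<notin> alg_numbers d H"
proof
  assume "1 \<in> alg_numbers d H"
  then obtain p where p: "primitive_min_poly p 1" "degree p = d" by (auto simp: alg_numbers_def)
  then have "degree p \<le> degree [:- 1, 1 :: int:]"
    unfolding primitive_min_poly_def by (elim conjE allE[of _ "[:- 1, 1:]"]) (simp add: map_poly_pCons)
  then show False using p assms by simp
qed

lemma finite_family_set: "finite (family_set X d H)"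
  by (cases X) (simp_all add: finite_alg_numbers alg_numbers_unit_def)

lemma card_family_set_ge:
  assumes "2 \<le> d" "5 \<le> H"
  shows "real H ^ Suc d / (4 * 10 ^ Suc d) \<le> real (card (family_set X d H))"
proof -
  have "alg_numbers_unit d H \<subseteq> family_set X d H"
    by (cases X) (auto simp: alg_numbers_unit_def)
  then have "card (alg_numbers_unit d H) \<le> card (family_set X d H)"
    by (intro card_mono finite_family_set)
  then show ?thesis
    using card_alg_numbers_unit_ge[of d H] assms by linarith
qed

lemma card_family_set_pos:
  assumes "2 \<le> d" "5 \<le> H"
  shows "0 < card (family_set X d H)"
proof -
  have "0 < real H ^ Suc d / (4 * 10 ^ Suc d)" using assms by simp
  then show ?thesis using card_family_set_ge[OF assms, of X] by linarith
qed

lemma card_family_interval_le: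
  assumes d: "2 \<le> d" and H: "5 \<le> H" and c: "c \<subseteq> {0..1}" and l: "0 \<le> l"
    and diam: "\<And>x y. x \<in> c \<Longrightarrow> y \<in> c \<Longrightarrow> \<bar>x - y\<bar> \<le> l"
  shows "real (card {\<alpha> \<in> family_set X d H. frac \<alpha> \<in> c})
    \<le> prop_const d * real (card (family_set X d H)) * (l + base_error X H)"
proof -
  have H1: "1 \<le> H" using H by simp
  have "real (card {\<alpha> \<in> family_set X d H. frac \<alpha> \<in> c})
      \<le> 7 * root_const d * real H ^ Suc d * (l + base_error X H)"
  proof (cases X)
    case Whole_Line
    have "{\<alpha> \<in> family_set X d H. frac \<alpha> \<in> c} \<subseteq> bounded_height_roots d H {\<alpha>. frac \<alpha> \<in> c}"
      using alg_numbers_subset[of d H] by (auto simp: Whole_Line bounded_height_roots_def)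
    then have "card {\<alpha> \<in> family_set X d H. frac \<alpha> \<in> c} \<le> card (bounded_height_roots d H {\<alpha>. frac \<alpha> \<in> c})"
      by (intro card_mono finite_bounded_height_roots)
    then show ?thesis
      using card_bounded_height_roots_frac_le[OF H1 c l diam, of d] by (simp add: Whole_Line)
  next
    case Unit_Interval
    have "{\<alpha> \<in> family_set X d H. frac \<alpha> \<in> c} \<subseteq> bounded_height_roots d H c"
    proof
      fix \<alpha> assume \<alpha>: "\<alpha> \<in> {\<alpha> \<in> family_set X d H. frac \<alpha> \<in> c}"
      then have "\<alpha> \<in> bounded_height_roots d H UNIV" "\<alpha> \<noteq> 1" "0 \<le> \<alpha>" "\<alpha> \<le> 1"
        using alg_numbers_subset[of d H] one_notin_alg_numbers[OF d, of H]
        by (auto simp: Unit_Interval alg_numbers_unit_def)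
      moreover from this have "frac \<alpha> = \<alpha>" by (simp add: frac_eq)
      ultimately show "\<alpha> \<in> bounded_height_roots d H c"
        using \<alpha> by (auto simp: bounded_height_roots_def)
    qed
    then have "card {\<alpha> \<in> family_set X d H. frac \<alpha> \<in> c} \<le> card (bounded_height_roots d H c)"
      by (intro card_mono finite_bounded_height_roots)
    moreover have "real (card (bounded_height_roots d H c)) \<le> root_const d * (l * real H ^ Suc d + real H ^ d)"
      using c by (intro card_bounded_height_roots_le[OF H1 _ l diam]) auto
    \<comment> \<open>No translates occur here, and \<open>H ^ d\<close> is
      \<open>H ^ Suc d / H\<close>, whence the smaller base error; the factor 7 is brought in next
      to share one constant.\<close>
    moreover have "root_const d * (l * real H ^ Suc d + real H ^ d)
        = 1 * root_const d * real H ^ Suc d * (l + base_error X H)"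
      using H1 by (simp add: Unit_Interval algebra_simps)
    moreover have "\<dots> \<le> 7 * root_const d * real H ^ Suc d * (l + base_error X H)"
      using root_const_pos[of d] l base_error_nonneg[of X H] by (intro mult_right_mono) auto
    ultimately show ?thesis by linarith
  qed
  also have "\<dots> = prop_const d * (real H ^ Suc d / (4 * 10 ^ Suc d)) * (l + base_error X H)"
    by (simp add: prop_const_def)
  also have "\<dots> \<le> prop_const d * real (card (family_set X d H)) * (l + base_error X H)"
    using l base_error_nonneg[of X H] prop_const_pos[of d]
    by (intro mult_right_mono mult_left_mono card_family_set_ge d H) auto
  finally show ?thesis .
qed

lemma proportion_in_le:
  assumes d: "2 \<le> d" and H: "5 \<le> H" and S: "S \<subseteq> {0..1}" "compact S" "finite (components S)"
    and m: "0 < m" "\<And>c. c \<in> components S \<Longrightarrow> m \<le> measure lebesgue c"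
  shows "proportion_in S X d H \<le> prop_const d * measure lebesgue S * (1 + base_error X H / m)"
proof -
  have "real (card {\<alpha> \<in> family_set X d H. frac \<alpha> \<in> S})
      \<le> prop_const d * real (card (family_set X d H)) * measure lebesgue S * (1 + base_error X H / m)"
    using prop_const_pos[of d] S(1)
    by (intro card_le_by_components S m finite_family_set base_error_nonneg
        card_family_interval_le d H abs_diff_le_measure) auto
  then show ?thesis
    using card_family_set_pos[OF d H, of X]
    by (simp add: proportion_in_def field_simps)
qed

text \<open>The left side is free of \<open>\<delta>\<close>; both \<open>1 / (1 - \<delta>)\<close>
  and \<open>1 + t\<close> are at least 1, so the required shape is reached by enlarging. The halved
  \<open>t\<close> costs the factor 2.\<close>

lemma bound_weaken:
  fixes K M e E t \<delta> :: real
  assumes "0 \<le> K" "0 \<le> M" "0 \<le> e" "e \<le> E" "0 < t" "0 < \<delta>" "\<delta> < 1"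
  shows "K * M * (1 + e / (t / 2)) \<le> 2 * K * M * (1 + t) * (1 / (1 - \<delta>) + E / t)"
proof -
  define u v w where "u = e / t" and "v = E / t" and "w = 1 / (1 - \<delta>)"
  have uvw: "0 \<le> u" "u \<le> v" "1 \<le> w"
    using assms by (auto simp: u_def v_def w_def divide_right_mono)
  have "1 + 2 * u \<le> 2 * (w + v)"
    using uvw by simp
  also have "2 * (w + v) \<le> (1 + t) * (2 * (w + v))"
    using mult_right_mono[of 1 "1 + t" "2 * (w + v)"] uvw \<open>0 < t\<close> by simp
  finally have "K * M * (1 + 2 * u) \<le> K * M * ((1 + t) * (2 * (w + v)))"
    using \<open>0 \<le> K\<close> \<open>0 \<le> M\<close> by (intro mult_left_mono mult_nonneg_nonneg)
  moreover have "e / (t / 2) = 2 * u"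
    by (simp add: u_def)
  moreover have "K * M * ((1 + t) * (2 * (w + v))) = 2 * K * M * (1 + t) * (w + v)"
    by simp
  ultimately show ?thesis
    unfolding v_def[symmetric] w_def[symmetric] by (simp only:)
qed

theorem theorem1p3:
  fixes d :: nat
  assumes "2 \<le> d"
  shows "\<exists>H0>0. \<exists>H0'>0. \<exists>C>0. \<exists>C'>0. \<forall>X. \<exists>C1>0. \<exists>C2>0.
    \<forall>\<Psi> Q1 Q2 H. approximation_function \<Psi> \<and> 1 \<le> Q1 \<and> Q1 < Q2 \<and> height_threshold H0 H0' X \<le> real H \<longrightarrow>
      (let J = J_set \<Psi> Q1 Q2; J' = J_tilde \<Psi> Q1 Q2;
           \<theta> = Theta_min \<Psi> Q1 Q2; len = min_component_length J';
           E = error_term C C' X d H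
       in
         (\<forall>\<delta>. 0 < \<delta> \<and> \<delta> < 1 \<and> 0 < \<theta> \<and> \<theta> < C1 * \<delta> \<longrightarrow>
            proportion_in J X d H
              \<le> C2 * measure lebesgue J * (1 + \<theta>) * (1 / (1 - \<delta>) + E / \<theta>)) \<and>
         (len = 0 \<longrightarrow> J = {0..1} \<and> proportion_in J X d H = 1) \<and>
         (len > 0 \<longrightarrow>
            (\<forall>\<delta>. 0 < \<delta> \<and> \<delta> < 1 \<and> len < C1 * \<delta> \<longrightarrow>
               1 - proportion_in J X d H
                 \<le> C2 * measure lebesgue J' * (1 + len) * (1 / (1 - \<delta>) + E / len))))"
proof -
  define K where "K = prop_const d"
  have K: "0 < K" by (simp add: K_def prop_const_pos)
  have upper: "proportion_in (J_set \<Psi> Q1 Q2) X d H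
      \<le> 2 * K * measure lebesgue (J_set \<Psi> Q1 Q2) * (1 + Theta_min \<Psi> Q1 Q2)
          * (1 / (1 - \<delta>) + error_term 1 1 X d H / Theta_min \<Psi> Q1 Q2)"
    if "1 \<le> Q1" "Q1 < Q2" "5 \<le> H" and \<delta>: "0 < \<delta>" "\<delta> < 1" "0 < Theta_min \<Psi> Q1 Q2" "Theta_min \<Psi> Q1 Q2 < \<delta>"
    for \<Psi> Q1 Q2 H X \<delta>
  proof -
    have "proportion_in (J_set \<Psi> Q1 Q2) X d H
        \<le> K * measure lebesgue (J_set \<Psi> Q1 Q2) * (1 + base_error X H / (Theta_min \<Psi> Q1 Q2 / 2))"
      unfolding K_def using \<delta>
      by (intro proportion_in_le assms that J_set_subset compact_J_set finite_components_J_set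
          component_J_set_measure_ge) auto
    also have "\<dots> \<le> 2 * K * measure lebesgue (J_set \<Psi> Q1 Q2) * (1 + Theta_min \<Psi> Q1 Q2)
          * (1 / (1 - \<delta>) + error_term 1 1 X d H / Theta_min \<Psi> Q1 Q2)"
      using K \<delta> by (intro bound_weaken base_error_nonneg base_error_le_error_term that) auto
    finally show ?thesis .
  qed
  have full: "J_set \<Psi> Q1 Q2 = {0..1} \<and> proportion_in (J_set \<Psi> Q1 Q2) X d H = 1"
    if "5 \<le> H" "min_component_length (J_tilde \<Psi> Q1 Q2) = 0" for \<Psi> Q1 Q2 H X
  proof -
    let ?J' = "J_tilde \<Psi> Q1 Q2"
    \<comment> \<open>The components are finitely many and of positive length, so a minimal length
      of 0 can only come from the empty set.\<close>
    have "?J' = {}"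
    proof (rule ccontr)
      assume "?J' \<noteq> {}"
      then have "Min (measure lebesgue ` components ?J') \<in> measure lebesgue ` components ?J'"
        by (intro Min_in) (auto simp: finite_components_J_tilde)
      then have "0 < Min (measure lebesgue ` components ?J')"
        using component_J_tilde_measure_pos by auto
      then show False using that \<open>?J' \<noteq> {}\<close> by (simp add: min_component_length_def)
    qed
    then have J: "J_set \<Psi> Q1 Q2 = {0..1}"
      using J_set_subset[of \<Psi> Q1 Q2] unfolding J_tilde_def by auto
    have "frac \<alpha> \<in> {0..1}" for \<alpha> :: real
      using frac_lt_1[of \<alpha>] by simp
    then show ?thesis
      unfolding J proportion_in_def using card_family_set_pos[OF assms \<open>5 \<le> H\<close>, of X] by simp
  qed
  have lower: "1 - proportion_in (J_set \<Psi> Q1 Q2) X d H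
      \<le> 2 * K * measure lebesgue (J_tilde \<Psi> Q1 Q2) * (1 + min_component_length (J_tilde \<Psi> Q1 Q2))
          * (1 / (1 - \<delta>) + error_term 1 1 X d H / min_component_length (J_tilde \<Psi> Q1 Q2))"
    if H: "5 \<le> H" and \<delta>: "0 < \<delta>" "\<delta> < 1" and len: "0 < min_component_length (J_tilde \<Psi> Q1 Q2)"
    for \<Psi> Q1 Q2 H X \<delta>
  proof -
    define A where "A = family_set X d H"
    define l where "l = min_component_length (J_tilde \<Psi> Q1 Q2)"
    have l: "0 < l" using len by (simp add: l_def)
    \<comment> \<open>Halving the available bound \<open>l\<close> brings the estimate into the form
      of \<open>bound_weaken\<close>.\<close>
    have comp: "l / 2 \<le> measure lebesgue c" if c: "c \<in> components (J_tilde \<Psi> Q1 Q2)" for c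
    proof -
      have "J_tilde \<Psi> Q1 Q2 \<noteq> {}" using c by auto
      then have "l \<le> measure lebesgue c"
        using c finite_components_J_tilde by (auto simp: l_def min_component_length_def intro!: Min_le)
      then show ?thesis using l by simp
    qed
    have pos: "0 < card A" unfolding A_def by (rule card_family_set_pos[OF assms H])
    have "frac \<alpha> \<in> J_tilde \<Psi> Q1 Q2" if "frac \<alpha> \<notin> J_set \<Psi> Q1 Q2" for \<alpha>
    proof -
      have "frac \<alpha> \<in> {0..1} - J_set \<Psi> Q1 Q2"
        using that frac_lt_1[of \<alpha>] by simp
      then show ?thesis using closure_subset unfolding J_tilde_def by blast
    qed
    then have "A \<subseteq> {\<alpha> \<in> A. frac \<alpha> \<in> J_set \<Psi> Q1 Q2} \<union> {\<alpha> \<in> A. frac \<alpha> \<in> J_tilde \<Psi> Q1 Q2}"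
      by auto
    then have "card A \<le> card ({\<alpha> \<in> A. frac \<alpha> \<in> J_set \<Psi> Q1 Q2} \<union> {\<alpha> \<in> A. frac \<alpha> \<in> J_tilde \<Psi> Q1 Q2})"
      by (intro card_mono) (simp_all add: A_def finite_family_set)
    also have "\<dots> \<le> card {\<alpha> \<in> A. frac \<alpha> \<in> J_set \<Psi> Q1 Q2} + card {\<alpha> \<in> A. frac \<alpha> \<in> J_tilde \<Psi> Q1 Q2}"
      by (rule card_Un_le)
    finally have "real (card A)
        \<le> real (card {\<alpha> \<in> A. frac \<alpha> \<in> J_set \<Psi> Q1 Q2}) + real (card {\<alpha> \<in> A. frac \<alpha> \<in> J_tilde \<Psi> Q1 Q2})"
      by linarith
    then have "real (card A) / real (card A)
        \<le> (real (card {\<alpha> \<in> A. frac \<alpha> \<in> J_set \<Psi> Q1 Q2})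
          + real (card {\<alpha> \<in> A. frac \<alpha> \<in> J_tilde \<Psi> Q1 Q2})) / real (card A)"
      by (intro divide_right_mono) auto
    then have "1 - proportion_in (J_set \<Psi> Q1 Q2) X d H \<le> proportion_in (J_tilde \<Psi> Q1 Q2) X d H"
      using pos unfolding proportion_in_def A_def[symmetric] by (simp add: add_divide_distrib)
    also have "\<dots> \<le> K * measure lebesgue (J_tilde \<Psi> Q1 Q2) * (1 + base_error X H / (l / 2))"
      unfolding K_def using l
      by (intro proportion_in_le assms H J_tilde_subset compact_J_tilde finite_components_J_tilde comp) auto
    also have "\<dots> \<le> 2 * K * measure lebesgue (J_tilde \<Psi> Q1 Q2) * (1 + l) * (1 / (1 - \<delta>) + error_term 1 1 X d H / l)"
      using K \<delta> l by (intro bound_weaken base_error_nonneg base_error_le_error_term H) auto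
    finally show ?thesis unfolding l_def .
  qed
  have threshold: "5 \<le> H" if "height_threshold 5 5 X \<le> real H" for X H
    using that by (cases X) auto
  show ?thesis
  \<comment> \<open>The threshold 5 serves both the family count and \<open>ln H \<ge> 1\<close>.
    With \<open>C1 = 1\<close> the hypothesis on \<open>Theta_min\<close> makes it smaller than 1,
    as the bound for components of \<open>J_set\<close> requires; \<open>C2 = 2 * K\<close> comes
    from \<open>bound_weaken\<close>.\<close>
  proof (rule exI[of _ 5], rule conjI, simp, rule exI[of _ 5], rule conjI, simp,
      rule exI[of _ 1], rule conjI, simp, rule exI[of _ 1], rule conjI, simp, rule allI,
      rule exI[of _ 1], rule conjI, simp, rule exI[of _ "2 * K"], rule conjI, simp add: K,
      unfold Let_def mult_1, intro allI impI, elim conjE,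
      (intro conjI allI impI; (elim conjE)?), goal_cases)
    case (1 X \<Psi> Q1 Q2 H \<delta>)
    show ?case by (rule upper[OF 1(2,3) threshold[OF 1(4)] 1(5-8)])
  next
    case (2 X \<Psi> Q1 Q2 H)
    show ?case by (rule full[OF threshold[OF 2(4)] 2(5), THEN conjunct1])
  next
    case (3 X \<Psi> Q1 Q2 H)
    show ?case by (rule full[OF threshold[OF 3(4)] 3(5), THEN conjunct2])
  next
    case (4 X \<Psi> Q1 Q2 H \<delta>)
    show ?case by (rule lower[OF threshold[OF 4(4)] 4(6,7,5)])
  qed
qed

end
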